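(* Let $d\ge2$, let $s\ge1$ be an integer, and let $W_0\hookrightarrow C_0^s(\mathbb{R}^d,\mathbb{R}^d)$ be a Hilbert space whose reproducing kernel is $K(x,y)=\mathbf{k}_{W_0}(x-y)$, where $\mathbf{k}_{W_0}$ is integrable and of the form $\mathbf{k}_{W_0}(x)=k_{W_0}(\|x\|)\mathbb{I}_d$, with Fourier transform $\widehat{\mathbf{k}}_{W_0}(\xi)=h(\|\xi\|)\mathbb{I}_d$. Define $\mathbf{k}_V$ via its Fourier transform as $\widehat{\mathbf{k}}_V(\xi)=h_V^\perp(\|\xi\|)\,\mathrm{Pr}_\xi^\perp$ with $h_V^\perp(\varrho)=(2\pi\varrho)^2h(\varrho)$, $\varrho>0$. Then $\mathbf{k}_V(x)=k_V^\parallel(\|x\|)\,\mathrm{Pr}_x^\parallel+k_V^\perp(\|x\|)\,\mathrm{Pr}_x^\perp$ for $x\ne0$, where $$k_V^\parallel(r)=-\frac{d-1}{r}\frac{dk_{W_0}}{dr}(r)\qquad\text{and}\qquad k_V^\perp(r)=-\frac{d-2}{r}\frac{dk_{W_0}}{dr}(r)-\frac{d^2k_{W_0}}{dr^2}(r),\qquad r>0.$$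
   Context: $C_0^s(\mathbb{R}^d,\mathbb{R}^d)$ is the Banach space of $C^s$ functions all of whose partial derivatives of order at most $s$ vanish at infinity, with norm $\sum_{|p|\le s}\sup_x\|\partial^pu(x)\|$; $X\hookrightarrow Y$ means $X\subseteq Y$ with continuous inclusion. The reproducing kernel $K$ of $W_0$ satisfies $K(\cdot,x)\alpha\in W_0$ and $\langle K(\cdot,x)\alpha,u\rangle_{W_0}=\alpha\cdot u(x)$ for all $u\in W_0$, $x,\alpha\in\mathbb{R}^d$. For $x\ne0$, $\mathrm{Pr}_x^\parallel:=xx^T/\|x\|^2$ and $\mathrm{Pr}_x^\perp:=\mathbb{I}_d-xx^T/\|x\|^2$. The Fourier transform is entrywise, $\widehat f(\xi)=\int_{\mathbb{R}^d}f(x)e^{-2\pi ix\cdot\xi}dx$; "defined via its Fourier transform" means $\mathbf{k}_V(x)=\int_{\mathbb{R}^d}\widehat{\mathbf{k}}_V(\xi)e^{2\pi ix\cdot\xi}d\xi$. *)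

theory Defs
  imports "HOL-Analysis.Analysis" "HOL-Library.Multiset"
begin

definition partial_deriv :: "'n \<Rightarrow> (real^'n \<Rightarrow> real^'n) \<Rightarrow> real^'n \<Rightarrow> real^'n" where
  "partial_deriv i u x = vector_derivative (\<lambda>t. u (x + t *\<^sub>R axis i 1)) (at 0)"

primrec partial_derivs :: "'n list \<Rightarrow> (real^'n \<Rightarrow> real^'n) \<Rightarrow> real^'n \<Rightarrow> real^'n" where
  "partial_derivs [] u = u"
| "partial_derivs (i # js) u = partial_deriv i (partial_derivs js u)"

definition C_diff :: "nat \<Rightarrow> (real^'n \<Rightarrow> real^'n) \<Rightarrow> bool" where
  "C_diff s u \<longleftrightarrow>
     (\<forall>js. length js < s \<longrightarrow>
        (\<forall>i x. (\<lambda>t. partial_derivs js u (x + t *\<^sub>R axis i 1)) differentiable (at 0))) \<and>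
     (\<forall>js. length js \<le> s \<longrightarrow> continuous_on UNIV (partial_derivs js u))"

text \<open>A multi-index is a function \<open>p\<close> from coordinates to naturals, of order \<open>sum p UNIV\<close>.
  The order in which the partial derivatives are taken is left unspecified; it is irrelevant
  for functions of class \<open>C\<^sup>s\<close> and \<open>sum p UNIV \<le> s\<close>.\<close>

definition multi_deriv :: "('n \<Rightarrow> nat) \<Rightarrow> (real^'n \<Rightarrow> real^'n) \<Rightarrow> real^'n \<Rightarrow> real^'n" where
  "multi_deriv p = partial_derivs (SOME js. \<forall>i. count_list js i = p i)"

definition C0_space :: "nat \<Rightarrow> (real^'n \<Rightarrow> real^'n) set" where
  "C0_space s = {u. C_diff s u \<and>
     (\<forall>p. sum p UNIV \<le> s \<longrightarrow> (multi_deriv p u \<longlongrightarrow> 0) at_infinity)}"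

definition C0_norm :: "nat \<Rightarrow> (real^'n \<Rightarrow> real^'n) \<Rightarrow> real" where
  "C0_norm s u = (\<Sum>p | sum p UNIV \<le> s. SUP x. norm (multi_deriv p u x))"

text \<open>The index set in \<^const>\<open>C0_norm\<close> is finite and the choice in \<^const>\<open>multi_deriv\<close>
  is never vacuous.\<close>

lemma finite_multi_indices: "finite {p :: 'n::finite \<Rightarrow> nat. sum p UNIV \<le> s}"
proof (rule finite_subset)
  show "{p :: 'n \<Rightarrow> nat. sum p UNIV \<le> s} \<subseteq> UNIV \<rightarrow>\<^sub>E {..s}"
  proof
    fix p :: "'n \<Rightarrow> nat" assume "p \<in> {p. sum p UNIV \<le> s}"
    moreover have "p i \<le> sum p UNIV" for i
      by (rule member_le_sum) auto
    ultimately show "p \<in> UNIV \<rightarrow>\<^sub>E {..s}"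
      by (auto intro: le_trans)
  qed
  show "finite ((UNIV :: 'n set) \<rightarrow>\<^sub>E {..s})"
    by (intro finite_PiE) auto
qed

lemma ex_list_multi_index:
  fixes p :: "'n::finite \<Rightarrow> nat"
  shows "\<exists>js. \<forall>i. count_list js i = p i"
proof -
  obtain js where js: "mset js = Abs_multiset p"
    using ex_mset by blast
  have "count_list js i = p i" for i
  proof -
    have "count_list js i = count (mset js) i"
      by (simp add: count_mset)
    then show ?thesis
      by (simp add: js count_Abs_multiset)
  qed
  then show ?thesis by blast
qed

text \<open>A Hilbert space of vector fields is represented by a type \<open>'w\<close> of class
  \<open>{real_inner, complete_space}\<close> together with the map \<open>\<iota>\<close> sending each element to the vector
  field that it is. The map being linear and injective, \<open>'w\<close> is identified with \<open>range \<iota>\<close>.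
  The last conjunct is continuity of the inclusion with respect to the two norms.\<close>

definition embedded_in_C0 ::
    "nat \<Rightarrow> ('w::{real_inner, complete_space} \<Rightarrow> real^'n \<Rightarrow> real^'n) \<Rightarrow> bool" where
  "embedded_in_C0 s \<iota> \<longleftrightarrow>
     (\<forall>v w. \<iota> (v + w) = (\<lambda>x. \<iota> v x + \<iota> w x)) \<and>
     (\<forall>c w. \<iota> (c *\<^sub>R w) = (\<lambda>x. c *\<^sub>R \<iota> w x)) \<and>
     inj \<iota> \<and>
     range \<iota> \<subseteq> C0_space s \<and>
     (\<forall>w. ((\<lambda>v. C0_norm s (\<lambda>x. \<iota> v x - \<iota> w x)) \<longlongrightarrow> 0) (at w))"

definition reproducing_kernel ::
    "('w::{real_inner, complete_space} \<Rightarrow> real^'n \<Rightarrow> real^'n) \<Rightarrow>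
     (real^'n \<Rightarrow> real^'n \<Rightarrow> real^'n^'n) \<Rightarrow> bool" where
  "reproducing_kernel \<iota> K \<longleftrightarrow>
     (\<forall>x \<alpha>. \<exists>w. \<iota> w = (\<lambda>y. K y x *v \<alpha>) \<and> (\<forall>u. w \<bullet> u = \<alpha> \<bullet> \<iota> u x))"

definition Pr_par :: "real^'n \<Rightarrow> real^'n^'n" where
  "Pr_par x = (1 / (norm x)\<^sup>2) *\<^sub>R (\<chi> i j. x $ i * x $ j)"

definition Pr_perp :: "real^'n \<Rightarrow> real^'n^'n" where
  "Pr_perp x = mat 1 - Pr_par x"

abbreviation complex_mat :: "real^'n^'n \<Rightarrow> complex^'n^'n" where
  "complex_mat \<equiv> map_matrix complex_of_real"

definition fourier :: "(real^'n \<Rightarrow> complex^'n^'n) \<Rightarrow> real^'n \<Rightarrow> complex^'n^'n" where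
  "fourier f \<xi> =
     (\<chi> i j. LINT x|lborel. f x $ i $ j * exp (- 2 * pi * \<i> * complex_of_real (x \<bullet> \<xi>)))"

definition inverse_fourier :: "(real^'n \<Rightarrow> complex^'n^'n) \<Rightarrow> real^'n \<Rightarrow> complex^'n^'n" where
  "inverse_fourier F x =
     (\<chi> i j. LINT \<xi>|lborel. F \<xi> $ i $ j * exp (2 * pi * \<i> * complex_of_real (x \<bullet> \<xi>)))"

end

theory Submission
  imports Defs "HOL-Probability.Probability"
begin

text \<open>Write \<open>f x = k\<^sub>W (norm x)\<close> and \<open>H \<xi> = h (norm \<xi>)\<close>. The reproducing kernel makes \<open>f\<close> positive
  definite, so \<open>H \<ge> 0\<close>, and Fourier inversion expresses \<open>f\<close> as the integral of \<open>H\<close> against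
  characters. The embedding into \<open>C\<^sub>0\<^sup>1\<close> makes \<open>x \<mapsto> K(\<cdot>, x) \<alpha>\<close> Lipschitz, which bounds the second
  moment of \<open>H\<close>; hence \<open>f\<close> is twice differentiable under the integral sign and \<open>k\<^sub>V = - \<Delta> f I + Hess f\<close>.
  The radial formulas are read off from the second derivatives of \<open>f\<close> along lines, by polarisation.\<close>

subsection \<open>Limits and affine changes of variables\<close>

text \<open>The prescribed transform equals (2 pi)^2 h (|\<xi>|^2 I - \<xi> \<xi>^T), the symbol of
  -Laplacian I + Hess applied to \<open>f\<close>. For radial \<open>f\<close> with profile k the
  Hessian is k'' along x and k'/r across it, and the Laplacian is k'' + (d-1) k'/r; subtracting
  gives both formulas. The obstacle is regularity. The hypotheses make the transform of
  \<open>f\<close> bounded, but do not state that it is integrable, and \<open>s\<close> may be 1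
  although \<open>f\<close> must be differentiated twice. The gain comes from
  \<open>f (x - y)\<close> being an inner product of two representers, \<open>k x\<close> and
  \<open>k y\<close>: |k x - k y|^2 = 2 f(0) - 2 f(x - y), so first order regularity of each factor
  is second order information on \<open>f\<close> at 0. The sign of the transform then turns bounds
  on integrals, all of them read off from values of \<open>f\<close> near 0, into absolute
  integrability, first of \<open>H\<close> and then of its second moment. After that only dominated
  convergence and algebra remain.\<close>

lemma integrable_of_bounded_integrals:
  fixes u :: "nat \<Rightarrow> 'a \<Rightarrow> real"
  assumes int: "\<And>n. integrable M (u n)"
    and nonneg: "\<And>n x. 0 \<le> u n x"
    and lim: "\<And>x. (\<lambda>n. u n x) \<longlonglongrightarrow> v x"
    and bound: "\<And>n. (\<integral>x. u n x \<partial>M) \<le> C"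
  shows "integrable M v"
proof (rule integrableI_nonneg)
  have [measurable]: "u n \<in> borel_measurable M" for n
    using int by auto
  show "v \<in> borel_measurable M"
    by (rule borel_measurable_LIMSEQ_real[OF lim]) measurable
  show "AE x in M. 0 \<le> v x"
    using LIMSEQ_le_const[OF lim] nonneg by auto
  have eq: "liminf (\<lambda>n. ennreal (u n x)) = ennreal (v x)" for x
    by (rule lim_imp_Liminf) (auto intro!: tendsto_ennrealI lim)
  have "(\<integral>\<^sup>+x. ennreal (v x) \<partial>M) = (\<integral>\<^sup>+x. liminf (\<lambda>n. ennreal (u n x)) \<partial>M)"
    by (simp add: eq)
  also have "\<dots> \<le> liminf (\<lambda>n. \<integral>\<^sup>+x. ennreal (u n x) \<partial>M)"
    by (rule nn_integral_liminf) measurable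
  also have "\<dots> \<le> liminf (\<lambda>n::nat. ennreal C)"
    by (rule Liminf_mono) (auto simp: nn_integral_eq_integral[OF int] nonneg ennreal_leI bound)
  also have "\<dots> < \<infinity>"
    by (simp add: Liminf_const)
  finally show "(\<integral>\<^sup>+x. ennreal (v x) \<partial>M) < \<infinity>" .
qed

text \<open>Dominated convergence along an arbitrary null sequence \<open>S\<close> of increments.
  In the application \<open>b\<close> is \<xi> \<mapsto> 2 pi (u \<bullet> \<xi>), so that
  \<open>t\<close> moves along a line in direction u.\<close>

lemma has_vector_derivative_integral_iexp:
  fixes a :: "'a \<Rightarrow> complex" and b :: "'a \<Rightarrow> real"
  assumes a: "integrable M a" and [measurable]: "b \<in> borel_measurable M"
    and ab: "integrable M (\<lambda>x. b x * a x)"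
  shows "((\<lambda>t. \<integral>x. a x * iexp (t * b x) \<partial>M) has_vector_derivative
           (\<integral>x. \<i> * b x * a x * iexp (t * b x) \<partial>M)) (at t)"
proof -
  have [measurable]: "a \<in> borel_measurable M"
    using a by auto
  have int_a: "integrable M (\<lambda>x. a x * iexp (t * b x))" for t
    by (rule Bochner_Integration.integrable_bound[OF a]) (simp_all add: norm_mult)
  have int_ab: "integrable M (\<lambda>x. \<i> * b x * a x * iexp (t * b x))" for t
    by (rule Bochner_Integration.integrable_bound[OF ab]) (simp_all add: norm_mult)
  define G where "G t = (\<integral>x. a x * iexp (t * b x) \<partial>M)" for t
  define D where "D = (\<integral>x. \<i> * b x * a x * iexp (t * b x) \<partial>M)"
  have "(\<lambda>n. norm (G (t + S n) - G t - S n *\<^sub>R D) / norm (S n)) \<longlonglongrightarrow> 0"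
    if S: "\<And>n. S n \<noteq> 0" and S0: "S \<longlonglongrightarrow> 0" for S :: "nat \<Rightarrow> real"
  proof -
    \<comment> \<open>\<open>q n\<close> is the difference quotient minus its limit, with
      \<open>a x * iexp (t * b x)\<close> pulled out so that only the Taylor remainder of
      \<open>iexp\<close> at 0 has to be estimated.\<close>
    define q where "q n x = a x * iexp (t * b x) * ((iexp (S n * b x) - 1 - \<i> * (S n * b x)) / S n)" for n x
    have [measurable]: "q n \<in> borel_measurable M" for n
      unfolding q_def by measurable
    have norm_q: "norm (q n x) = norm (a x) * (cmod (iexp (S n * b x) - 1 - \<i> * (S n * b x)) / \<bar>S n\<bar>)" for n x
      by (simp add: q_def norm_mult norm_divide)
    \<comment> \<open>\<open>e1\<close> yields the pointwise limit, but as a majorant it would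
      involve b^2 a, which is not assumed integrable. \<open>e0\<close> costs a single power of
      \<open>b\<close> and yields the majorant 2 |b a|.\<close>
    have e0: "cmod (iexp \<theta> - 1) \<le> \<bar>\<theta>\<bar>" for \<theta>
      using iexp_approx1[of \<theta> 0] by simp
    have e1: "cmod (iexp \<theta> - 1 - \<i> * \<theta>) \<le> \<theta>\<^sup>2 / 2" for \<theta>
      using iexp_approx1[of \<theta> 1] by (simp add: algebra_simps power2_eq_square)
    have "(\<lambda>n. \<integral>x. q n x \<partial>M) \<longlonglongrightarrow> (\<integral>x. 0 \<partial>M)"
    proof (rule integral_dominated_convergence[where w="\<lambda>x. 2 * norm (b x * a x)"])
      show "AE x in M. (\<lambda>n. q n x) \<longlonglongrightarrow> 0"
      proof (rule AE_I2, rule Lim_null_comparison)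
        fix x
        show "\<forall>\<^sub>F n in sequentially. norm (q n x) \<le> norm (a x) * (\<bar>S n\<bar> * (b x)\<^sup>2 / 2)"
        proof (intro always_eventually allI)
          fix n
          have "cmod (iexp (S n * b x) - 1 - \<i> * (S n * b x)) / \<bar>S n\<bar> \<le> ((S n * b x)\<^sup>2 / 2) / \<bar>S n\<bar>"
            using e1[of "S n * b x"] by (intro divide_right_mono) simp_all
          also have "\<dots> = \<bar>S n\<bar> * (b x)\<^sup>2 / 2"
          proof -
            have "(S n)\<^sup>2 = \<bar>S n\<bar> * \<bar>S n\<bar>"
              by (simp add: power2_eq_square)
            then have "(S n * b x)\<^sup>2 = \<bar>S n\<bar> * (\<bar>S n\<bar> * (b x)\<^sup>2)"
              by (simp only: power_mult_distrib mult.assoc)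
            then show ?thesis
              using S[of n] by simp
          qed
          finally show "norm (q n x) \<le> norm (a x) * (\<bar>S n\<bar> * (b x)\<^sup>2 / 2)"
            unfolding norm_q by (rule mult_left_mono) simp
        qed
        show "(\<lambda>n. norm (a x) * (\<bar>S n\<bar> * (b x)\<^sup>2 / 2)) \<longlonglongrightarrow> 0"
          using tendsto_mult[OF tendsto_const[of "norm (a x)"] tendsto_mult[OF tendsto_rabs_zero[OF S0] tendsto_const[of "(b x)\<^sup>2 / 2"]]]
          by simp
      qed
      show "AE x in M. norm (q n x) \<le> 2 * norm (b x * a x)" for n
      proof (intro AE_I2)
        fix x
        have "cmod (iexp (S n * b x) - 1 - \<i> * (S n * b x)) \<le> cmod (iexp (S n * b x) - 1) + cmod (\<i> * (S n * b x))"
          by (rule norm_triangle_ineq4)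
        also have "\<dots> \<le> 2 * \<bar>S n\<bar> * \<bar>b x\<bar>"
          using e0[of "S n * b x"] by (simp add: norm_mult abs_mult)
        finally have "cmod (iexp (S n * b x) - 1 - \<i> * (S n * b x)) / \<bar>S n\<bar> \<le> 2 * \<bar>b x\<bar>"
          using S[of n] by (simp add: field_simps)
        from mult_left_mono[OF this, of "norm (a x)"]
        show "norm (q n x) \<le> 2 * norm (b x * a x)"
          unfolding norm_q by (simp add: norm_mult mult_ac)
      qed
      show "integrable M (\<lambda>x. 2 * norm (b x * a x))"
        using ab by simp
    qed simp_all
    then have "(\<lambda>n. norm (\<integral>x. q n x \<partial>M)) \<longlonglongrightarrow> 0"
      by (simp add: tendsto_norm_zero)
    moreover have "norm (G (t + S n) - G t - S n *\<^sub>R D) / norm (S n) = norm (\<integral>x. q n x \<partial>M)" for n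
    proof -
      have q: "q n x = (1 / S n) * (a x * iexp ((t + S n) * b x) - a x * iexp (t * b x)
                   - S n * (\<i> * b x * a x * iexp (t * b x)))" for x
        using S[of n] by (simp add: q_def field_simps exp_add distrib_right)
      have "has_bochner_integral M (\<lambda>x. a x * iexp ((t + S n) * b x) - a x * iexp (t * b x)
          - S n * (\<i> * b x * a x * iexp (t * b x))) (G (t + S n) - G t - S n * D)"
        unfolding G_def D_def
        by (intro has_bochner_integral_diff has_bochner_integral_mult_right
            has_bochner_integral_integrable int_a int_ab)
      then have "has_bochner_integral M (q n) ((1 / S n) * (G (t + S n) - G t - S n * D))"
        unfolding q by (intro has_bochner_integral_mult_right)
      then have "(\<integral>x. q n x \<partial>M) = (1 / S n) * (G (t + S n) - G t - S n * D)"
        by (rule has_bochner_integral_integral_eq)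
      then show ?thesis
        by (simp add: norm_mult norm_divide scaleR_conv_of_real)
    qed
    ultimately show ?thesis by simp
  qed
  then have "((\<lambda>s. norm (G (t + s) - G t - s *\<^sub>R D) / norm s) \<longlongrightarrow> 0) (at 0)"
    by (auto simp: tendsto_at_iff_sequentially comp_def)
  then have "(G has_vector_derivative D) (at t)"
    unfolding has_vector_derivative_def has_derivative_at by (simp add: bounded_linear_scaleR_left)
  then show ?thesis
    by (simp add: G_def[abs_def] D_def)
qed

lemma lborel_integral_affine:
  fixes f :: "'a::euclidean_space \<Rightarrow> 'b::{banach, second_countable_topology}"
  assumes [measurable]: "f \<in> borel_measurable borel" and "c \<noteq> 0"
  shows "(\<integral>x. f x \<partial>lborel) = \<bar>c\<bar> ^ DIM('a) *\<^sub>R (\<integral>x. f (t + c *\<^sub>R x) \<partial>lborel)"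
  by (subst lborel_affine[OF \<open>c \<noteq> 0\<close>, of t]) (simp add: integral_density integral_distr)

lemma lborel_integrable_affine:
  fixes f :: "'a::euclidean_space \<Rightarrow> 'b::{banach, second_countable_topology}"
  assumes "integrable lborel f" "c \<noteq> 0"
  shows "integrable lborel (\<lambda>x. f (t + c *\<^sub>R x))"
proof -
  have [measurable]: "f \<in> borel_measurable borel"
    using borel_measurable_integrable[OF assms(1)] by simp
  have "integrable (density (distr lborel borel (\<lambda>x. t + c *\<^sub>R x)) (\<lambda>_. ennreal (\<bar>c\<bar> ^ DIM('a)))) f"
    using assms lborel_affine[OF \<open>c \<noteq> 0\<close>, of t] by simp
  then have "integrable lborel (\<lambda>x. \<bar>c\<bar> ^ DIM('a) *\<^sub>R f (t + c *\<^sub>R x))"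
    by (subst (asm) integrable_density) (simp_all add: integrable_distr_eq)
  from integrable_scaleR_right[OF this, of "1 / \<bar>c\<bar> ^ DIM('a)"] show ?thesis
    using \<open>c \<noteq> 0\<close> by simp
qed

lemma lborel_prod_inner_Basis:
  fixes f :: "'a::euclidean_space \<Rightarrow> real \<Rightarrow> 'b::{real_normed_field, banach, second_countable_topology}"
  assumes "\<And>b. b \<in> Basis \<Longrightarrow> integrable lborel (f b)"
  shows "integrable lborel (\<lambda>x::'a. \<Prod>b\<in>Basis. f b (x \<bullet> b))" (is ?int)
    and "(\<integral>x. (\<Prod>b\<in>(Basis::'a set). f b (x \<bullet> b)) \<partial>lborel) = (\<Prod>b\<in>Basis. (\<integral>t. f b t \<partial>lborel))" (is ?eq)
proof -
  interpret product_sigma_finite "\<lambda>b::'a. lborel :: real measure" ..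
  have [measurable]: "f b \<in> borel_measurable borel" if "b \<in> Basis" for b
    using borel_measurable_integrable[OF assms[OF that]] by simp
  have m: "(\<lambda>x::'a. \<Prod>b\<in>Basis. f b (x \<bullet> b)) \<in> borel_measurable borel"
    by measurable
  have comp: "(\<Prod>b\<in>Basis. f b ((\<Sum>c\<in>Basis. x c *\<^sub>R c) \<bullet> b)) = (\<Prod>b\<in>Basis. f b (x b))" for x :: "'a \<Rightarrow> real"
    by (intro prod.cong refl) (simp add: inner_sum_left inner_Basis if_distrib cong: if_cong)
  show ?int
    by (subst lborel_eq, subst integrable_distr_eq)
       (use m in \<open>auto simp: comp intro!: product_integrable_prod assms\<close>)
  show ?eq
    by (subst lborel_eq, subst integral_distr)
       (use m in \<open>auto simp: comp intro!: product_integral_prod assms\<close>)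
qed

subsection \<open>Gaussians and Fourier inversion\<close>

text \<open>This is the characteristic function of the standard normal distribution; the factor
  \<open>sqrt (2 * pi)\<close> undoes the normalisation of its density.\<close>

lemma gaussian_fourier_real:
  fixes s :: real
  shows "integrable lborel (\<lambda>t. complex_of_real (exp (- t\<^sup>2 / 2)) * iexp (s * t))"
    and "(\<integral>t. complex_of_real (exp (- t\<^sup>2 / 2)) * iexp (s * t) \<partial>lborel) = of_real (sqrt (2 * pi) * exp (- s\<^sup>2 / 2))"
proof -
  have eq: "complex_of_real (exp (- t\<^sup>2 / 2)) * iexp (s * t) = sqrt (2 * pi) * (std_normal_density t *\<^sub>R iexp (s * t))" for t :: real
    by (simp add: std_normal_density_def scaleR_conv_of_real)
  have "integrable lborel (\<lambda>t. std_normal_density t *\<^sub>R iexp (s * t))"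
    by (rule Bochner_Integration.integrable_bound[OF integrable_normal_density[of 1 0]]) simp_all
  then show "integrable lborel (\<lambda>t. complex_of_real (exp (- t\<^sup>2 / 2)) * iexp (s * t))"
    unfolding eq by (intro integrable_mult_right)
  have "char std_normal_distribution s = (\<integral>t. std_normal_density t *\<^sub>R iexp (s * t) \<partial>lborel)"
    unfolding char_def by (subst integral_density) (simp_all add: normal_density_nonneg)
  then have "(\<integral>t. std_normal_density t *\<^sub>R iexp (s * t) \<partial>lborel) = of_real (exp (- s\<^sup>2 / 2))"
    by (simp add: char_std_normal_distribution)
  then show "(\<integral>t. complex_of_real (exp (- t\<^sup>2 / 2)) * iexp (s * t) \<partial>lborel) = of_real (sqrt (2 * pi) * exp (- s\<^sup>2 / 2))"
    unfolding eq integral_mult_right_zero by simp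
qed

text \<open>Left unnormalised, so that its value at 0 is 1. Composed with a scaling that tends to 0
  it is a cutoff tending to 1; divided by its mass \<open>sqrt (2 * pi) ^ DIM('a)\<close> it is an
  averaging kernel. Both roles occur below.\<close>

definition gaussian :: "'a::euclidean_space \<Rightarrow> real" where
  "gaussian u = exp (- (norm u)\<^sup>2 / 2)"

lemma gaussian_pos: "0 < gaussian u"
  and gaussian_le_1: "gaussian u \<le> 1"
  and gaussian_measurable [measurable]: "gaussian \<in> borel_measurable borel"
  by (simp_all add: gaussian_def[abs_def])

lemma gaussian_zero [simp]: "gaussian 0 = 1"
  by (simp add: gaussian_def)

lemma gaussian_scale_tendsto: "(\<lambda>n. gaussian (inverse (real (Suc n)) *\<^sub>R u)) \<longlonglongrightarrow> 1"
proof -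
  have "(\<lambda>n. exp (- (norm (inverse (real (Suc n)) *\<^sub>R u))\<^sup>2 / 2)) \<longlonglongrightarrow> exp (- (norm (0 *\<^sub>R u))\<^sup>2 / 2)"
    by (intro tendsto_intros LIMSEQ_inverse_real_of_nat) simp
  then show ?thesis
    by (simp add: gaussian_def)
qed

lemma gaussian_fourier:
  fixes z :: "'a::euclidean_space"
  shows "integrable lborel (\<lambda>u. gaussian u * iexp (z \<bullet> u))"
    and "(\<integral>u. gaussian u * iexp (z \<bullet> u) \<partial>lborel) = sqrt (2 * pi) ^ DIM('a) * gaussian z"
proof -
  have norm_sq: "(norm u)\<^sup>2 = (\<Sum>b\<in>Basis. (u \<bullet> b)\<^sup>2)" for u :: 'a
    unfolding power2_norm_eq_inner by (subst euclidean_inner) (simp add: power2_eq_square)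
  have gauss: "gaussian u = (\<Prod>b\<in>Basis. exp (- (u \<bullet> b)\<^sup>2 / 2))" for u :: 'a
    by (simp add: gaussian_def norm_sq exp_sum[symmetric] sum_negf sum_divide_distrib)
  have eq: "gaussian u * iexp (z \<bullet> u) = (\<Prod>b\<in>Basis. complex_of_real (exp (- (u \<bullet> b)\<^sup>2 / 2)) * iexp ((z \<bullet> b) * (u \<bullet> b)))" for u
  proof -
    have "iexp (z \<bullet> u) = (\<Prod>b\<in>Basis. iexp ((z \<bullet> b) * (u \<bullet> b)))"
      by (subst euclidean_inner) (simp add: exp_sum sum_distrib_left)
    then show ?thesis
      by (simp add: gauss prod.distrib)
  qed
  show "integrable lborel (\<lambda>u. gaussian u * iexp (z \<bullet> u))"
    unfolding eq by (intro lborel_prod_inner_Basis gaussian_fourier_real)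
  have "(\<integral>u. gaussian u * iexp (z \<bullet> u) \<partial>lborel)
      = of_real (\<Prod>b\<in>(Basis::'a set). sqrt (2 * pi) * exp (- (z \<bullet> b)\<^sup>2 / 2))"
    unfolding eq by (subst lborel_prod_inner_Basis(2)) (simp_all only: gaussian_fourier_real of_real_prod)
  then show "(\<integral>u. gaussian u * iexp (z \<bullet> u) \<partial>lborel) = sqrt (2 * pi) ^ DIM('a) * gaussian z"
    by (simp add: gauss prod.distrib)
qed

lemma integrable_gaussian: "integrable lborel (gaussian :: 'a::euclidean_space \<Rightarrow> real)"
  using gaussian_fourier(1)[of "0::'a"] by (simp add: complex_of_real_integrable_eq)

lemma integral_gaussian: "(\<integral>u. gaussian (u::'a::euclidean_space) \<partial>lborel) = sqrt (2 * pi) ^ DIM('a)"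
proof -
  have "complex_of_real (\<integral>u. gaussian (u::'a) \<partial>lborel) = of_real (sqrt (2 * pi) ^ DIM('a))"
    using gaussian_fourier(2)[of "0::'a"] by (simp add: integral_complex_of_real)
  then show ?thesis
    by (simp only: of_real_eq_iff)
qed

lemma integrable_lborel_pair_mult:
  fixes f :: "'a::euclidean_space \<Rightarrow> real" and g :: "'b::euclidean_space \<Rightarrow> real"
  assumes f: "integrable lborel f" and g: "integrable lborel g"
  shows "integrable (lborel \<Otimes>\<^sub>M lborel) (\<lambda>(x, y). f x * g y)"
proof (rule lborel_pair.Fubini_integrable)
  have [measurable]: "f \<in> borel_measurable borel" "g \<in> borel_measurable borel"
    using f g by auto
  show "(\<lambda>(x, y). f x * g y) \<in> borel_measurable (lborel \<Otimes>\<^sub>M lborel)"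
    by measurable
  show "integrable lborel (\<lambda>x. \<integral>y. norm (case (x, y) of (x, y) \<Rightarrow> f x * g y) \<partial>lborel)"
    using f by (simp add: abs_mult)
  show "AE x in lborel. integrable lborel (\<lambda>y. case (x, y) of (x, y) \<Rightarrow> f x * g y)"
    using g by simp
qed

text \<open>Multiplying the Fourier transform by a Gaussian before inverting it amounts to averaging
  \<open>f\<close> against a Gaussian; this is what makes the inversion integral absolutely convergent.\<close>

lemma gaussian_regularised_inversion:
  fixes f :: "'a::euclidean_space \<Rightarrow> complex"
  assumes f: "integrable lborel f" and e: "e > 0"
  shows "(\<integral>\<xi>. (\<integral>y. f y * iexp (- (2 * pi * (y \<bullet> \<xi>))) \<partial>lborel) * gaussian (e *\<^sub>R \<xi>) * iexp (2 * pi * (x \<bullet> \<xi>)) \<partial>lborel)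
    = (\<integral>u. f (x - (e / (2 * pi)) *\<^sub>R u) * gaussian u \<partial>lborel) / sqrt (2 * pi) ^ DIM('a)"
proof -
  have [measurable]: "f \<in> borel_measurable borel"
    using f by auto
  have gauss_int: "integrable lborel (\<lambda>\<xi>::'a. gaussian (e *\<^sub>R \<xi>))"
    using lborel_integrable_affine[OF integrable_gaussian, of e 0] e by simp
  let ?k = "\<lambda>\<xi> y. f y * gaussian (e *\<^sub>R \<xi>) * iexp (2 * pi * ((x - y) \<bullet> \<xi>))"
  have inner: "(\<integral>\<xi>. ?k \<xi> y \<partial>lborel)
      = f y * (sqrt (2 * pi) ^ DIM('a) * gaussian ((2 * pi / e) *\<^sub>R (x - y)) / e ^ DIM('a))" for y
  proof -
    let ?z = "(2 * pi / e) *\<^sub>R (x - y)"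
    have "(\<integral>u. gaussian u * iexp (?z \<bullet> u) \<partial>lborel)
        = e ^ DIM('a) *\<^sub>R (\<integral>\<xi>. gaussian (e *\<^sub>R \<xi>) * iexp (2 * pi * ((x - y) \<bullet> \<xi>)) \<partial>lborel)"
      using e by (subst lborel_integral_affine[of _ e 0]) (simp_all add: mult_ac)
    then have "(\<integral>\<xi>. gaussian (e *\<^sub>R \<xi>) * iexp (2 * pi * ((x - y) \<bullet> \<xi>)) \<partial>lborel)
        = sqrt (2 * pi) ^ DIM('a) * gaussian ?z / e ^ DIM('a)"
      unfolding gaussian_fourier(2) using e by (simp add: scaleR_conv_of_real field_simps)
    then show ?thesis
      by (simp only: mult.assoc integral_mult_right_zero)
  qed
  have "(\<integral>\<xi>. (\<integral>y. f y * iexp (- (2 * pi * (y \<bullet> \<xi>))) \<partial>lborel) * gaussian (e *\<^sub>R \<xi>) * iexp (2 * pi * (x \<bullet> \<xi>)) \<partial>lborel)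
      = (\<integral>\<xi>. (\<integral>y. ?k \<xi> y \<partial>lborel) \<partial>lborel)"
  proof (intro Bochner_Integration.integral_cong refl)
    fix \<xi>
    have "f y * iexp (- (2 * pi * (y \<bullet> \<xi>))) * (gaussian (e *\<^sub>R \<xi>) * iexp (2 * pi * (x \<bullet> \<xi>))) = ?k \<xi> y" for y
    proof -
      have "iexp (- (2 * pi * (y \<bullet> \<xi>))) * iexp (2 * pi * (x \<bullet> \<xi>)) = iexp (2 * pi * ((x - y) \<bullet> \<xi>))"
        unfolding mult_exp_exp by (simp add: inner_diff_left algebra_simps)
      then show ?thesis
        by (simp only: mult_ac)
    qed
    then show "(\<integral>y. f y * iexp (- (2 * pi * (y \<bullet> \<xi>))) \<partial>lborel) * gaussian (e *\<^sub>R \<xi>) * iexp (2 * pi * (x \<bullet> \<xi>))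
        = (\<integral>y. ?k \<xi> y \<partial>lborel)"
      by (simp only: mult.assoc integral_mult_left_zero[symmetric])
  qed
  also have "\<dots> = (\<integral>y. (\<integral>\<xi>. ?k \<xi> y \<partial>lborel) \<partial>lborel)"
  proof (rule lborel_pair.Fubini_integral)
    show "integrable (lborel \<Otimes>\<^sub>M lborel) (\<lambda>(y, \<xi>). ?k \<xi> y)"
      by (rule Bochner_Integration.integrable_bound[OF
            integrable_lborel_pair_mult[OF integrable_norm[OF f] gauss_int]])
         (auto simp: norm_mult abs_mult)
  qed
  also have "\<dots> = (\<integral>y. f y * (sqrt (2 * pi) ^ DIM('a) * gaussian ((2 * pi / e) *\<^sub>R (x - y)) / e ^ DIM('a)) \<partial>lborel)"
    by (simp only: inner)
  \<comment> \<open>The substitution y = x - (e / (2 pi)) u is the one that turns the Gaussian of (2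
    pi / e) (x - y) into \<open>gaussian u\<close>.\<close>
  also have "\<dots> = (e / (2 * pi)) ^ DIM('a) *\<^sub>R
      (\<integral>u. f (x - (e / (2 * pi)) *\<^sub>R u) * (sqrt (2 * pi) ^ DIM('a) * gaussian u / e ^ DIM('a)) \<partial>lborel)"
  proof -
    have g: "gaussian (- u) = gaussian u" for u :: 'a
      by (simp add: gaussian_def)
    show ?thesis
      using e by (subst lborel_integral_affine[of _ "- (e / (2 * pi))" x]) (simp_all add: g)
  qed
  also have "\<dots> = (e / (2 * pi)) ^ DIM('a) * (sqrt (2 * pi) ^ DIM('a) / e ^ DIM('a)) *
      (\<integral>u. f (x - (e / (2 * pi)) *\<^sub>R u) * gaussian u \<partial>lborel)"
    by (simp add: scaleR_conv_of_real mult_ac flip: integral_mult_right_zero)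
  \<comment> \<open>The powers of \<open>e\<close> cancel, and what is left is the reciprocal mass
    of \<open>gaussian\<close>: the right-hand side is a genuine average of
    \<open>f\<close>.\<close>
  also have "(e / (2 * pi)) ^ DIM('a) * (sqrt (2 * pi) ^ DIM('a) / e ^ DIM('a)) = 1 / sqrt (2 * pi) ^ DIM('a)"
  proof -
    have "2 * pi = sqrt (2 * pi) * sqrt (2 * pi)"
      by simp
    then have "(e / (2 * pi)) ^ DIM('a) = e ^ DIM('a) / (sqrt (2 * pi) ^ DIM('a) * sqrt (2 * pi) ^ DIM('a))"
      by (metis power_divide power_mult_distrib)
    then show ?thesis
      using e by simp
  qed
  finally show ?thesis
    by simp
qed

text \<open>Nonnegativity makes integrability of the transform a conclusion. The regularised
  inversion at 0 is an average of \<open>f\<close>, hence at most \<open>C\<close>, and for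
  nonnegative integrands a uniform bound survives removal of the cutoff. With \<open>H\<close>
  integrable, both sides of the regularised formula converge.\<close>

lemma fourier_inversion_nonneg:
  fixes f :: "'a::euclidean_space \<Rightarrow> complex" and H :: "'a \<Rightarrow> real"
  assumes f: "integrable lborel f" and cont: "continuous_on UNIV f" and bd: "\<And>x. norm (f x) \<le> C"
    and H: "\<And>\<xi>. (\<integral>y. f y * iexp (- (2 * pi * (y \<bullet> \<xi>))) \<partial>lborel) = of_real (H \<xi>)"
    and H_nonneg: "\<And>\<xi>. 0 \<le> H \<xi>"
  shows "integrable lborel H"
    and "f x = (\<integral>\<xi>. H \<xi> * iexp (2 * pi * (x \<bullet> \<xi>)) \<partial>lborel)"
proof -
  have [measurable]: "f \<in> borel_measurable borel"
    using f by auto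
  have H_Re: "H = (\<lambda>\<xi>. Re (\<integral>y. f y * iexp (- (2 * pi * (y \<bullet> \<xi>))) \<partial>lborel))"
    using H by auto
  have H_meas [measurable]: "H \<in> borel_measurable borel"
    unfolding H_Re by measurable
  have H_le: "H \<xi> \<le> (\<integral>y. norm (f y) \<partial>lborel)" for \<xi>
  proof -
    have "H \<xi> \<le> norm (\<integral>y. f y * iexp (- (2 * pi * (y \<bullet> \<xi>))) \<partial>lborel)"
      unfolding H by simp
    also have "\<dots> \<le> (\<integral>y. norm (f y * iexp (- (2 * pi * (y \<bullet> \<xi>)))) \<partial>lborel)"
      by (rule integral_norm_bound)
    finally show ?thesis
      by (simp add: norm_mult)
  qed
  have C: "0 \<le> C"
    using bd[of 0] norm_ge_zero by (rule order_trans[rotated])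
  have f_gaussian_le: "norm (f y * gaussian v) \<le> C * gaussian v" for y v :: 'a
    using gaussian_pos[of v] bd[of y] by (simp add: norm_mult mult_right_mono)
  define e where "e n = inverse (real (Suc n))" for n
  have e: "e n > 0" for n
    by (simp add: e_def)
  define u where "u n \<xi> = H \<xi> * gaussian (e n *\<^sub>R \<xi>)" for n \<xi>
  have [measurable]: "u n \<in> borel_measurable borel" for n
    unfolding u_def by measurable
  have u_nonneg: "0 \<le> u n \<xi>" for n \<xi>
    using gaussian_pos[of "e n *\<^sub>R \<xi>"] H_nonneg[of \<xi>] by (simp add: u_def)
  have u_int: "integrable lborel (u n)" for n
  proof (rule Bochner_Integration.integrable_bound)
    show "integrable lborel (\<lambda>\<xi>. (\<integral>y. norm (f y) \<partial>lborel) * gaussian (e n *\<^sub>R \<xi> :: 'a))"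
      using lborel_integrable_affine[OF integrable_gaussian[where 'a='a], of "e n" 0] e[of n] by simp
    have "H \<xi> * gaussian (e n *\<^sub>R \<xi>) \<le> (\<integral>y. norm (f y) \<partial>lborel) * gaussian (e n *\<^sub>R \<xi>)" for \<xi>
      by (intro mult_right_mono H_le less_imp_le gaussian_pos)
    then show "AE \<xi> in lborel. norm (u n \<xi>) \<le> norm ((\<integral>y. norm (f y) \<partial>lborel) * gaussian (e n *\<^sub>R \<xi>))"
      using u_nonneg by (auto simp: u_def intro: order_trans[OF _ abs_ge_self])
  qed simp
  have u_lim: "(\<lambda>n. u n \<xi>) \<longlonglongrightarrow> H \<xi>" for \<xi>
    using tendsto_mult[OF tendsto_const gaussian_scale_tendsto, of "H \<xi>" \<xi>] by (simp add: u_def e_def)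
  have u_inv: "(\<integral>\<xi>. u n \<xi> * iexp (2 * pi * (x \<bullet> \<xi>)) \<partial>lborel)
      = (\<integral>v. f (x - (e n / (2 * pi)) *\<^sub>R v) * gaussian v \<partial>lborel) / sqrt (2 * pi) ^ DIM('a)" for n x
    unfolding gaussian_regularised_inversion[OF f e, symmetric] H by (simp add: u_def)
  show H_int: "integrable lborel H"
  proof (rule integrable_of_bounded_integrals[OF u_int u_nonneg u_lim])
    fix n
    \<comment> \<open>At the point 0 every character equals 1, so the plain integral of
      \<open>u n\<close> is already a regularised inversion integral.\<close>
    have "complex_of_real (\<integral>\<xi>. u n \<xi> \<partial>lborel) = (\<integral>\<xi>. u n \<xi> * iexp (2 * pi * (0 \<bullet> \<xi>)) \<partial>lborel)"
      by (simp add: integral_complex_of_real)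
    also have "norm \<dots> \<le> (\<integral>v. norm (f (0 - (e n / (2 * pi)) *\<^sub>R v) * gaussian v) \<partial>lborel) / sqrt (2 * pi) ^ DIM('a)"
      unfolding u_inv by (simp add: norm_divide norm_power divide_right_mono integral_norm_bound)
    also have "\<dots> \<le> (\<integral>v. C * gaussian (v::'a) \<partial>lborel) / sqrt (2 * pi) ^ DIM('a)"
    proof (intro divide_right_mono integral_mono_AE')
      show "AE v in lborel. norm (f (0 - (e n / (2 * pi)) *\<^sub>R v) * gaussian v) \<le> C * gaussian v"
        by (intro AE_I2) (rule f_gaussian_le)
    qed (simp_all add: integrable_gaussian C gaussian_pos less_imp_le)
    also have "\<dots> = C"
      by (simp add: integral_gaussian)
    finally show "(\<integral>\<xi>. u n \<xi> \<partial>lborel) \<le> C"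
      by simp
  qed
  have "(\<lambda>n. \<integral>\<xi>. u n \<xi> * iexp (2 * pi * (x \<bullet> \<xi>)) \<partial>lborel) \<longlonglongrightarrow> (\<integral>\<xi>. H \<xi> * iexp (2 * pi * (x \<bullet> \<xi>)) \<partial>lborel)"
  proof (rule integral_dominated_convergence[where w=H])
    show "AE \<xi> in lborel. (\<lambda>n. complex_of_real (u n \<xi>) * iexp (2 * pi * (x \<bullet> \<xi>))) \<longlonglongrightarrow> of_real (H \<xi>) * iexp (2 * pi * (x \<bullet> \<xi>))"
      by (intro AE_I2 tendsto_intros u_lim)
    show "AE \<xi> in lborel. norm (complex_of_real (u n \<xi>) * iexp (2 * pi * (x \<bullet> \<xi>))) \<le> H \<xi>" for n
    proof (intro AE_I2)
      fix \<xi>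
      have "u n \<xi> \<le> H \<xi>"
        using mult_left_mono[OF gaussian_le_1 H_nonneg] by (simp add: u_def)
      then show "norm (complex_of_real (u n \<xi>) * iexp (2 * pi * (x \<bullet> \<xi>))) \<le> H \<xi>"
        using u_nonneg by (simp add: norm_mult)
    qed
  qed (use H_int in simp_all)
  \<comment> \<open>The averages concentrate at x as \<open>e n\<close> tends to 0; continuity of
    \<open>f\<close> gives the limit and the bound \<open>C\<close> the domination.\<close>
  moreover have "(\<lambda>n. \<integral>\<xi>. u n \<xi> * iexp (2 * pi * (x \<bullet> \<xi>)) \<partial>lborel) \<longlonglongrightarrow> f x"
  proof -
    have "(\<lambda>n. \<integral>v. f (x - (e n / (2 * pi)) *\<^sub>R v) * gaussian v \<partial>lborel) \<longlonglongrightarrow> (\<integral>v. f x * gaussian (v::'a) \<partial>lborel)"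
    proof (rule integral_dominated_convergence[where w="\<lambda>v. C * gaussian v"])
      show "AE v in lborel. (\<lambda>n. f (x - (e n / (2 * pi)) *\<^sub>R v) * complex_of_real (gaussian v)) \<longlonglongrightarrow> f x * of_real (gaussian v)"
      proof (intro AE_I2 tendsto_intros)
        fix v :: 'a
        have "(\<lambda>n. x - (e n / (2 * pi)) *\<^sub>R v) \<longlonglongrightarrow> x - (0 / (2 * pi)) *\<^sub>R v"
          unfolding e_def by (intro tendsto_intros LIMSEQ_inverse_real_of_nat) simp
        then have "(\<lambda>n. x - (e n / (2 * pi)) *\<^sub>R v) \<longlonglongrightarrow> x"
          by simp
        moreover have "isCont f x"
          using cont by (simp add: continuous_on_eq_continuous_at)
        ultimately show "(\<lambda>n. f (x - (e n / (2 * pi)) *\<^sub>R v)) \<longlonglongrightarrow> f x"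
          by (metis isCont_tendsto_compose)
      qed
      show "AE v in lborel. norm (f (x - (e n / (2 * pi)) *\<^sub>R v) * complex_of_real (gaussian v)) \<le> C * gaussian v" for n
        by (intro AE_I2) (rule f_gaussian_le)
    qed (simp_all add: integrable_gaussian C gaussian_pos less_imp_le)
    from tendsto_divide[OF this tendsto_const, of "of_real (sqrt (2 * pi) ^ DIM('a))"]
    show ?thesis
      unfolding u_inv by (simp add: integral_complex_of_real integral_gaussian)
  qed
  ultimately show "f x = (\<integral>\<xi>. H \<xi> * iexp (2 * pi * (x \<bullet> \<xi>)) \<partial>lborel)"
    by (rule LIMSEQ_unique[symmetric])
qed

subsection \<open>Positive definiteness\<close>

lemma riesz_representation:
  fixes T :: "'w::{real_inner, complete_space} \<Rightarrow> real"
  assumes "bounded_linear T"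
  obtains w where "\<And>u. T u = w \<bullet> u"
proof -
  interpret T: bounded_linear T by fact
  text \<open>The representer is the minimiser of \<open>J\<close>.\<close>
  define J where "J w = w \<bullet> w - 2 * T w" for w
  obtain B where B: "\<And>u. norm (T u) \<le> norm u * B"
    using T.bounded by blast
  have "- B\<^sup>2 \<le> J w" for w
  proof -
    have "0 \<le> (norm w - B)\<^sup>2"
      by simp
    also have "\<dots> \<le> J w + B\<^sup>2"
      using B[of w] by (simp add: J_def power2_diff power2_norm_eq_inner mult_ac)
    finally show ?thesis by simp
  qed
  then have bdd: "bdd_below (range J)"
    by (auto intro!: bdd_belowI)
  define m where "m = Inf (range J)"
  have m_le: "m \<le> J w" for w
    unfolding m_def by (rule cInf_lower) (use bdd in auto)
  have "\<exists>w. J w < m + inverse (real (Suc n))" for n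
  proof -
    have "\<exists>y\<in>range J. y < m + inverse (real (Suc n))"
      unfolding m_def by (intro cInf_lessD) auto
    then show ?thesis by auto
  qed
  then obtain v where v: "\<And>n. J (v n) < m + inverse (real (Suc n))"
    by metis
  \<comment> \<open>\<open>J\<close> is at least \<open>m\<close> at the midpoint of a and b, so the
    parallelogram law bounds their distance by how far they exceed the infimum; hence a minimising
    sequence is Cauchy.\<close>
  have parallelogram: "(norm (a - b))\<^sup>2 \<le> 2 * (J a - m) + 2 * (J b - m)" for a b
  proof -
    have "(norm (a - b))\<^sup>2 = 2 * J a + 2 * J b - 4 * J ((1 / 2) *\<^sub>R (a + b))"
      unfolding J_def power2_norm_eq_inner
      by (simp add: T.scaleR T.add algebra_simps inner_commute)
    then show ?thesis
      using m_le[of "(1 / 2) *\<^sub>R (a + b)"] by (simp add: right_diff_distrib)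
  qed
  have "Cauchy v"
  proof (rule metric_CauchyI)
    fix e :: real assume e: "0 < e"
    have "(\<lambda>n. 4 * inverse (real (Suc n))) \<longlonglongrightarrow> 4 * 0"
      by (intro tendsto_intros LIMSEQ_inverse_real_of_nat)
    then have "\<forall>\<^sub>F n in sequentially. 4 * inverse (real (Suc n)) < e\<^sup>2"
      by (rule order_tendstoD) (use e in simp)
    then obtain N where N: "\<And>n. n \<ge> N \<Longrightarrow> 4 * inverse (real (Suc n)) < e\<^sup>2"
      by (auto simp: eventually_sequentially)
    have "dist (v i) (v j) < e" if "i \<ge> N" "j \<ge> N" for i j
    proof -
      have "(norm (v i - v j))\<^sup>2 < e\<^sup>2"
        using parallelogram[of "v i" "v j"] v[of i] v[of j] N[OF that(1)] N[OF that(2)] by argo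
      then show ?thesis
        using e by (simp add: dist_norm power2_less_imp_less)
    qed
    then show "\<exists>M. \<forall>i\<ge>M. \<forall>j\<ge>M. dist (v i) (v j) < e"
      by blast
  qed
  then obtain w where w: "v \<longlonglongrightarrow> w"
    using Cauchy_convergent convergent_def by blast
  have "(\<lambda>n. J (v n)) \<longlonglongrightarrow> J w"
    unfolding J_def by (intro tendsto_intros w T.tendsto)
  moreover have "(\<lambda>n. m + inverse (real (Suc n))) \<longlonglongrightarrow> m + 0"
    by (intro tendsto_intros LIMSEQ_inverse_real_of_nat)
  ultimately have "J w \<le> m + 0"
    by (rule LIMSEQ_le) (use v less_imp_le in blast)
  then have J_min: "J w \<le> J u" for u
    using m_le[of u] by simp
  have "T u = w \<bullet> u" for u
  proof (rule ccontr)
    assume ne: "T u \<noteq> w \<bullet> u"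
    define d where "d = T u - w \<bullet> u"
    have key: "2 * t * d \<le> t\<^sup>2 * (u \<bullet> u)" for t
    proof -
      have "J (w + t *\<^sub>R u) = J w - 2 * t * d + t\<^sup>2 * (u \<bullet> u)"
        unfolding J_def d_def
        by (simp add: T.add T.scaleR algebra_simps inner_commute power2_eq_square)
      then show ?thesis
        using J_min[of "w + t *\<^sub>R u"] by linarith
    qed
    have "u \<noteq> 0"
      using ne T.zero by auto
    then have "u \<bullet> u > 0"
      by simp
    \<comment> \<open>This \<open>t\<close> minimises t^2 (u \<bullet> u) - 2 t d, and the minimum
      -d^2 / (u \<bullet> u) would be negative.\<close>
    with key[of "d / (u \<bullet> u)"] have "2 * d\<^sup>2 \<le> d\<^sup>2"
      by (simp add: power2_eq_square field_simps)
    then show False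
      using ne by (simp add: d_def)
  qed
  then show ?thesis
    using that by blast
qed

text \<open>The double integral is the squared norm of the integral of \<phi> k. Only the pairings
  \<open>k x \<bullet> u\<close> are assumed measurable and the Hilbert space is not assumed
  separable, so that integral is taken weakly, as the Riesz representer of \<open>T\<close>.\<close>

lemma integral_positive_definite:
  fixes k :: "'a::euclidean_space \<Rightarrow> 'w::{real_inner, complete_space}" and f :: "'a \<Rightarrow> real"
  assumes kernel: "\<And>x y. k x \<bullet> k y = f (x - y)"
    and [measurable]: "\<And>u. (\<lambda>x. k x \<bullet> u) \<in> borel_measurable borel"
    and \<phi>: "integrable lborel \<phi>"
  shows "0 \<le> (\<integral>y. \<phi> y * (\<integral>x. \<phi> x * f (x - y) \<partial>lborel) \<partial>lborel)"
proof -
  have [measurable]: "\<phi> \<in> borel_measurable borel"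
    using \<phi> by auto
  have norm_k: "norm (k x) = sqrt (f 0)" for x
    using kernel[of x x] by (simp add: norm_eq_sqrt_inner)
  have bound: "\<bar>\<phi> x * (k x \<bullet> u)\<bar> \<le> \<bar>\<phi> x\<bar> * (sqrt (f 0) * norm u)" for x u
    using Cauchy_Schwarz_ineq2[of "k x" u] by (simp add: abs_mult norm_k mult_left_mono)
  have int: "integrable lborel (\<lambda>x. \<phi> x * (k x \<bullet> u))" for u
    by (rule Bochner_Integration.integrable_bound[where f="\<lambda>x. \<bar>\<phi> x\<bar> * (sqrt (f 0) * norm u)"])
       (use \<phi> bound in \<open>auto intro: order_trans[OF _ abs_ge_self]\<close>)
  define T where "T u = (\<integral>x. \<phi> x * (k x \<bullet> u) \<partial>lborel)" for u
  have "bounded_linear T"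
  proof (rule bounded_linear_intro)
    show "T (u + v) = T u + T v" for u v
      unfolding T_def by (simp add: inner_add_right distrib_left int)
    show "T (c *\<^sub>R u) = c *\<^sub>R T u" for c u
      unfolding T_def by (simp add: mult.left_commute[of _ c])
    show "norm (T u) \<le> norm u * ((\<integral>x. \<bar>\<phi> x\<bar> \<partial>lborel) * sqrt (f 0))" for u
    proof -
      have "norm (T u) \<le> (\<integral>x. norm (\<phi> x * (k x \<bullet> u)) \<partial>lborel)"
        unfolding T_def by (rule integral_norm_bound)
      also have "\<dots> \<le> (\<integral>x. \<bar>\<phi> x\<bar> * (sqrt (f 0) * norm u) \<partial>lborel)"
        by (rule integral_mono) (use int \<phi> bound in auto)
      finally show ?thesis
        by (simp add: mult_ac)
    qed
  qed
  then obtain w where w: "\<And>u. T u = w \<bullet> u"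
    using riesz_representation by blast
  have "0 \<le> T w"
    by (simp add: w)
  \<comment> \<open>Expanding \<open>T w\<close> gives an integral of pairings of \<open>w\<close>
    with \<open>k y\<close>, and each of these is \<open>T (k y)\<close> because \<open>w\<close>
    represents \<open>T\<close>.\<close>
  also have "T w = (\<integral>y. \<phi> y * T (k y) \<partial>lborel)"
    unfolding w by (subst w[symmetric]) (simp add: T_def inner_commute)
  finally show ?thesis
    by (simp add: T_def kernel)
qed

text \<open>The easy half of Bochner's theorem. Test functions must be real and integrable, so the
  character is split into cosine and sine and cut off by a Gaussian. Adding the two quadratic forms
  restores cos (w \<bullet> (x - y)); the cutoff is removed at the end by dominated
  convergence.\<close>

lemma cos_transform_nonneg:
  fixes f :: "'a::euclidean_space \<Rightarrow> real"
  assumes f: "integrable lborel f" and bd: "\<And>x. \<bar>f x\<bar> \<le> C"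
    and posdef: "\<And>\<phi>. integrable lborel \<phi> \<Longrightarrow>
      0 \<le> (\<integral>y. \<phi> y * (\<integral>x. \<phi> x * f (x - y) \<partial>lborel) \<partial>lborel)"
  shows "0 \<le> (\<integral>z. f z * cos (w \<bullet> z) \<partial>lborel)"
proof -
  have [measurable]: "f \<in> borel_measurable borel"
    using f by auto
  have regularised: "0 \<le> (\<integral>z. f z * cos (w \<bullet> z) * gaussian (\<delta> *\<^sub>R z) \<partial>lborel)" if \<delta>: "\<delta> > 0" for \<delta>
  proof -
    \<comment> \<open>The factor \<open>sqrt 2\<close> is chosen so that completing the square in
      \<gamma>(y) \<gamma>(y + z) splits off exactly the cutoff
      \<open>gaussian (\<delta> *\<^sub>R z)\<close> of the claim, as |y|^2 + |y + z|^2 = (|z|^2 +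
      |z + 2 y|^2) / 2.\<close>
    define \<gamma> where "\<gamma> x = gaussian ((sqrt 2 * \<delta>) *\<^sub>R x)" for x :: 'a
    have [measurable]: "\<gamma> \<in> borel_measurable borel"
      unfolding \<gamma>_def by measurable
    have \<gamma>: "integrable lborel \<gamma>"
      using lborel_integrable_affine[OF integrable_gaussian, of "sqrt 2 * \<delta>" 0] \<delta>
      by (simp add: \<gamma>_def[abs_def])
    have \<gamma>_pos: "0 < \<gamma> x" for x
      by (simp add: \<gamma>_def gaussian_pos)
    define Q where "Q \<phi> y = (\<integral>x. \<phi> x * f (x - y) \<partial>lborel)" for \<phi> :: "'a \<Rightarrow> real" and y
    have modulated: "integrable lborel (\<lambda>x. \<gamma> x * c x)" "integrable lborel (\<lambda>x. \<gamma> x * c x * f (x - y))"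
        "integrable lborel (\<lambda>y. \<gamma> y * c y * Q (\<lambda>x. \<gamma> x * c x) y)"
      if [measurable]: "c \<in> borel_measurable borel" and c: "\<And>x. \<bar>c x\<bar> \<le> 1" for c :: "'a \<Rightarrow> real" and y
    proof -
      have le: "\<bar>\<gamma> x * c x\<bar> \<le> \<gamma> x" for x
        using c[of x] \<gamma>_pos[of x] by (simp add: abs_mult mult_left_le)
      show 1: "integrable lborel (\<lambda>x. \<gamma> x * c x)"
        by (rule Bochner_Integration.integrable_bound[OF \<gamma>])
           (use le in \<open>auto intro: order_trans[OF _ abs_ge_self]\<close>)
      have 2: "integrable lborel (\<lambda>x. \<gamma> x * C)"
        using \<gamma> by simp
      have le2: "\<bar>\<gamma> x * c x * f (x - y)\<bar> \<le> \<gamma> x * C" for x y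
        using mult_mono[OF le[of x] bd[of "x - y"]] \<gamma>_pos[of x] by (simp add: abs_mult less_imp_le)
      show 3: "integrable lborel (\<lambda>x. \<gamma> x * c x * f (x - y))" for y
        by (rule Bochner_Integration.integrable_bound[OF 2])
           (use le2 in \<open>auto intro: order_trans[OF _ abs_ge_self]\<close>)
      have Q: "\<bar>Q (\<lambda>x. \<gamma> x * c x) y\<bar> \<le> (\<integral>x. \<gamma> x * C \<partial>lborel)" for y
      proof -
        have "norm (Q (\<lambda>x. \<gamma> x * c x) y) \<le> (\<integral>x. norm (\<gamma> x * c x * f (x - y)) \<partial>lborel)"
          unfolding Q_def by (rule integral_norm_bound)
        also have "\<dots> \<le> (\<integral>x. \<gamma> x * C \<partial>lborel)"
          by (rule integral_mono) (use 2 3 le2 in auto)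
        finally show ?thesis by simp
      qed
      have [measurable]: "Q (\<lambda>x. \<gamma> x * c x) \<in> borel_measurable borel"
        unfolding Q_def by measurable
      show "integrable lborel (\<lambda>y. \<gamma> y * c y * Q (\<lambda>x. \<gamma> x * c x) y)"
      proof (rule Bochner_Integration.integrable_bound)
        show "integrable lborel (\<lambda>y. \<gamma> y * (\<integral>x. \<gamma> x * C \<partial>lborel))"
          using \<gamma> by simp
        have "\<bar>\<gamma> y * c y * Q (\<lambda>x. \<gamma> x * c x) y\<bar> \<le> \<gamma> y * (\<integral>x. \<gamma> x * C \<partial>lborel)" for y
          using mult_mono[OF le[of y] Q[of y]] \<gamma>_pos[of y] by (simp add: abs_mult less_imp_le)
        then show "AE y in lborel. norm (\<gamma> y * c y * Q (\<lambda>x. \<gamma> x * c x) y)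
            \<le> norm (\<gamma> y * (\<integral>x. \<gamma> x * C \<partial>lborel))"
          by (auto intro: order_trans[OF _ abs_ge_self])
      qed simp
    qed
    let ?c = "\<lambda>x. cos (w \<bullet> x)" and ?s = "\<lambda>x. sin (w \<bullet> x)"
    have cs: "?c \<in> borel_measurable borel" "?s \<in> borel_measurable borel"
      by measurable
    note mc = modulated[OF cs(1)] and ms = modulated[OF cs(2)]
    have "0 \<le> (\<integral>y. \<gamma> y * ?c y * Q (\<lambda>x. \<gamma> x * ?c x) y \<partial>lborel) + (\<integral>y. \<gamma> y * ?s y * Q (\<lambda>x. \<gamma> x * ?s x) y \<partial>lborel)"
      using posdef[OF mc(1)] posdef[OF ms(1)] by (simp add: Q_def)
    also have "\<dots> = (\<integral>y. (\<gamma> y * ?c y * Q (\<lambda>x. \<gamma> x * ?c x) y + \<gamma> y * ?s y * Q (\<lambda>x. \<gamma> x * ?s x) y) \<partial>lborel)"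
      by (rule Bochner_Integration.integral_add[symmetric]) (simp_all add: mc ms)
    also have "\<dots> = (\<integral>y. (\<integral>z. \<gamma> y * \<gamma> (y + z) * (f z * cos (w \<bullet> z)) \<partial>lborel) \<partial>lborel)"
    proof (intro Bochner_Integration.integral_cong refl)
      fix y
      have "\<gamma> y * ?c y * Q (\<lambda>x. \<gamma> x * ?c x) y + \<gamma> y * ?s y * Q (\<lambda>x. \<gamma> x * ?s x) y
          = (\<integral>x. \<gamma> y * ?c y * (\<gamma> x * ?c x * f (x - y)) \<partial>lborel) + (\<integral>x. \<gamma> y * ?s y * (\<gamma> x * ?s x * f (x - y)) \<partial>lborel)"
        unfolding Q_def by simp
      also have "\<dots> = (\<integral>x. \<gamma> y * ?c y * (\<gamma> x * ?c x * f (x - y)) + \<gamma> y * ?s y * (\<gamma> x * ?s x * f (x - y)) \<partial>lborel)"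
        by (rule Bochner_Integration.integral_add[symmetric]) (intro integrable_mult_right mc ms; simp)+
      also have "\<dots> = (\<integral>x. \<gamma> y * \<gamma> x * (f (x - y) * cos (w \<bullet> (x - y))) \<partial>lborel)"
        by (intro Bochner_Integration.integral_cong refl)
           (simp add: inner_diff_right cos_diff algebra_simps)
      also have "\<dots> = (\<integral>z. \<gamma> y * \<gamma> (y + z) * (f z * cos (w \<bullet> z)) \<partial>lborel)"
        by (subst lborel_integral_affine[of _ 1 y]) simp_all
      finally show "\<gamma> y * ?c y * Q (\<lambda>x. \<gamma> x * ?c x) y + \<gamma> y * ?s y * Q (\<lambda>x. \<gamma> x * ?s x) y
          = (\<integral>z. \<gamma> y * \<gamma> (y + z) * (f z * cos (w \<bullet> z)) \<partial>lborel)" .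
    qed
    also have "\<dots> = (\<integral>z. (\<integral>y. \<gamma> y * \<gamma> (y + z) * (f z * cos (w \<bullet> z)) \<partial>lborel) \<partial>lborel)"
    proof (rule lborel_pair.Fubini_integral)
      show "integrable (lborel \<Otimes>\<^sub>M lborel) (\<lambda>(z, y). \<gamma> y * \<gamma> (y + z) * (f z * cos (w \<bullet> z)))"
      proof (rule Bochner_Integration.integrable_bound[OF integrable_lborel_pair_mult[OF f \<gamma>]])
        have "\<bar>\<gamma> y * \<gamma> (y + z) * (f z * cos (w \<bullet> z))\<bar> \<le> \<bar>f z * \<gamma> y\<bar>" for y z
        proof -
          have "\<bar>\<gamma> (y + z) * cos (w \<bullet> z)\<bar> \<le> 1"
            using \<gamma>_pos[of "y + z"] by (simp add: abs_mult \<gamma>_def mult_le_one gaussian_le_1)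
          from mult_left_mono[OF this, of "\<bar>f z * \<gamma> y\<bar>"] show ?thesis
            by (simp add: abs_mult mult_ac)
        qed
        then show "AE x in lborel \<Otimes>\<^sub>M lborel. norm (case x of (z, y) \<Rightarrow> \<gamma> y * \<gamma> (y + z) * (f z * cos (w \<bullet> z)))
           \<le> norm (case x of (z, y) \<Rightarrow> f z * \<gamma> y)"
          by (intro AE_I2) (simp add: split_beta)
      qed measurable
    qed
    also have "\<dots> = (\<integral>z. f z * cos (w \<bullet> z) * gaussian (\<delta> *\<^sub>R z) * (sqrt (2 * pi) / (2 * \<delta>)) ^ DIM('a) \<partial>lborel)"
    proof (intro Bochner_Integration.integral_cong refl)
      fix z
      have complete_square: "\<gamma> y * \<gamma> (y + z) = gaussian (\<delta> *\<^sub>R z) * gaussian (\<delta> *\<^sub>R z + (2 * \<delta>) *\<^sub>R y)" for y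
      proof -
        have "2 * (y \<bullet> y) + 2 * ((y + z) \<bullet> (y + z)) = z \<bullet> z + (z + 2 *\<^sub>R y) \<bullet> (z + 2 *\<^sub>R y)"
          by (simp add: algebra_simps inner_commute)
        then have "\<delta>\<^sup>2 * (2 * (y \<bullet> y) + 2 * ((y + z) \<bullet> (y + z))) = \<delta>\<^sup>2 * (z \<bullet> z + (z + 2 *\<^sub>R y) \<bullet> (z + 2 *\<^sub>R y))"
          by simp
        moreover have "\<delta> *\<^sub>R z + (2 * \<delta>) *\<^sub>R y = \<delta> *\<^sub>R (z + 2 *\<^sub>R y)"
          by (simp add: algebra_simps)
        ultimately show ?thesis
          by (simp only: \<gamma>_def gaussian_def mult_exp_exp norm_scaleR power_mult_distrib power2_abs
              real_sqrt_pow2 abs_mult power2_norm_eq_inner) (simp add: field_simps)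
      qed
      \<comment> \<open>By translation invariance the remaining Gaussian in y has a mass independent
        of z, so it leaves the integral as a positive constant.\<close>
      have "sqrt (2 * pi) ^ DIM('a) = (2 * \<delta>) ^ DIM('a) * (\<integral>y. gaussian (\<delta> *\<^sub>R z + (2 * \<delta>) *\<^sub>R y) \<partial>lborel)"
        using \<delta> unfolding integral_gaussian[where 'a='a, symmetric]
        by (subst lborel_integral_affine[of _ "2 * \<delta>" "\<delta> *\<^sub>R z"]) simp_all
      then have "(\<integral>y. gaussian (\<delta> *\<^sub>R z + (2 * \<delta>) *\<^sub>R y) \<partial>lborel) = (sqrt (2 * pi) / (2 * \<delta>)) ^ DIM('a)"
        using \<delta> by (simp add: power_divide)
      then show "(\<integral>y. \<gamma> y * \<gamma> (y + z) * (f z * cos (w \<bullet> z)) \<partial>lborel)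
          = f z * cos (w \<bullet> z) * gaussian (\<delta> *\<^sub>R z) * (sqrt (2 * pi) / (2 * \<delta>)) ^ DIM('a)"
        unfolding complete_square by simp
    qed
    also have "\<dots> = (\<integral>z. f z * cos (w \<bullet> z) * gaussian (\<delta> *\<^sub>R z) \<partial>lborel) * (sqrt (2 * pi) / (2 * \<delta>)) ^ DIM('a)"
      by simp
    finally have "0 \<le> (\<integral>z. f z * cos (w \<bullet> z) * gaussian (\<delta> *\<^sub>R z) \<partial>lborel) * (sqrt (2 * pi) / (2 * \<delta>)) ^ DIM('a)" .
    moreover have "0 < (sqrt (2 * pi) / (2 * \<delta>)) ^ DIM('a)"
      using \<delta> by simp
    ultimately show ?thesis
      by (rule mult_right_le_imp_le[of 0, simplified mult_zero_left])
  qed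
  have "(\<lambda>n. \<integral>z. f z * cos (w \<bullet> z) * gaussian (inverse (real (Suc n)) *\<^sub>R z) \<partial>lborel)
      \<longlonglongrightarrow> (\<integral>z. f z * cos (w \<bullet> z) \<partial>lborel)"
  proof (rule integral_dominated_convergence[where w="\<lambda>z. \<bar>f z\<bar>"])
    show "AE z in lborel. (\<lambda>n. f z * cos (w \<bullet> z) * gaussian (inverse (real (Suc n)) *\<^sub>R z)) \<longlonglongrightarrow> f z * cos (w \<bullet> z)"
      using tendsto_mult[OF tendsto_const gaussian_scale_tendsto] by (intro AE_I2) fastforce
    have "\<bar>f z * cos (w \<bullet> z) * gaussian (t *\<^sub>R z)\<bar> \<le> \<bar>f z\<bar>" for z t
    proof -
      have "\<bar>cos (w \<bullet> z) * gaussian (t *\<^sub>R z)\<bar> \<le> 1"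
        using gaussian_le_1[of "t *\<^sub>R z"] gaussian_pos[of "t *\<^sub>R z"] by (simp add: abs_mult mult_le_one)
      from mult_left_mono[OF this, of "\<bar>f z\<bar>"] show ?thesis
        by (simp add: abs_mult mult_ac)
    qed
    then show "AE z in lborel. norm (f z * cos (w \<bullet> z) * gaussian (inverse (real (Suc n)) *\<^sub>R z)) \<le> \<bar>f z\<bar>" for n
      by simp
  qed (use f in simp_all)
  then show ?thesis
    by (rule LIMSEQ_le_const) (use regularised in auto)
qed

subsection \<open>Spectra of translation-invariant kernels\<close>

text \<open>All \<open>k x\<close> have the same norm, so Cauchy-Schwarz bounds \<open>f\<close> by
  f(0). The transform is real by hypothesis and therefore equals the cosine transform, whose sign
  comes from positive definiteness.\<close>

lemma translation_kernel_spectrum: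
  fixes k :: "'a::euclidean_space \<Rightarrow> 'w::{real_inner, complete_space}" and f H :: "'a \<Rightarrow> real"
  assumes kernel: "\<And>x y. k x \<bullet> k y = f (x - y)"
    and cont: "\<And>u. continuous_on UNIV (\<lambda>x. k x \<bullet> u)"
    and f: "integrable lborel f"
    and H: "\<And>\<xi>. (\<integral>y. f y * iexp (- (2 * pi * (y \<bullet> \<xi>))) \<partial>lborel) = of_real (H \<xi>)"
  shows "0 \<le> H \<xi>" and "integrable lborel H"
    and "of_real (f x) = (\<integral>\<xi>. H \<xi> * iexp (2 * pi * (x \<bullet> \<xi>)) \<partial>lborel)"
proof -
  have meas: "(\<lambda>x. k x \<bullet> u) \<in> borel_measurable borel" for u
    using cont by (rule borel_measurable_continuous_onI)
  have f_eq: "f = (\<lambda>x. k x \<bullet> k 0)"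
    by (simp add: kernel)
  have "norm (k x) = sqrt (f 0)" for x
    using kernel[of x x] by (simp add: norm_eq_sqrt_inner)
  then have bd: "\<bar>f x\<bar> \<le> sqrt (f 0) * sqrt (f 0)" for x
    unfolding f_eq by (metis Cauchy_Schwarz_ineq2)
  have H_eq: "H \<xi> = (\<integral>z. f z * cos ((2 * pi) *\<^sub>R \<xi> \<bullet> z) \<partial>lborel)" for \<xi>
  proof -
    have int: "integrable lborel (\<lambda>y. f y * iexp (- (2 * pi * (y \<bullet> \<xi>))))"
    proof (rule Bochner_Integration.integrable_bound[OF f])
      show "(\<lambda>y. f y * iexp (- (2 * pi * (y \<bullet> \<xi>)))) \<in> borel_measurable lborel"
        using borel_measurable_integrable[OF f] by simp
    qed (simp add: norm_mult)
    have "H \<xi> = Re (\<integral>y. f y * iexp (- (2 * pi * (y \<bullet> \<xi>))) \<partial>lborel)"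
      by (simp only: H Re_complex_of_real)
    also have "\<dots> = (\<integral>y. Re (f y * iexp (- (2 * pi * (y \<bullet> \<xi>)))) \<partial>lborel)"
      by (rule integral_Re[OF int, symmetric])
    finally show ?thesis
      by (simp add: Re_exp inner_commute)
  qed
  show H_nonneg: "0 \<le> H \<xi>" for \<xi>
    unfolding H_eq
    by (rule cos_transform_nonneg[OF f bd integral_positive_definite[OF kernel meas]])
  have "continuous_on UNIV f"
    unfolding f_eq by (rule cont)
  then have cf: "continuous_on UNIV (\<lambda>x. complex_of_real (f x))"
    by (intro continuous_intros)
  have "integrable lborel (\<lambda>x. complex_of_real (f x))"
    using f by (simp add: complex_of_real_integrable_eq)
  note inv = fourier_inversion_nonneg[OF this cf _ H H_nonneg, of "sqrt (f 0) * sqrt (f 0)"]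
  show "integrable lborel H" "of_real (f x) = (\<integral>\<xi>. H \<xi> * iexp (2 * pi * (x \<bullet> \<xi>)) \<partial>lborel)"
    using inv bd by (simp_all only: norm_of_real)
qed

text \<open>The Lipschitz bound controls the integrals of \<open>(2 - 2 cos (2 \<pi> t b \<bullet> \<xi>)) / t\<^sup>2 * H \<xi>\<close>
  uniformly in \<open>t\<close>, and Fatou's lemma applies as \<open>t \<rightarrow> 0\<close>.\<close>

lemma translation_kernel_second_moment:
  fixes k :: "'a::euclidean_space \<Rightarrow> 'w::real_inner" and f H :: "'a \<Rightarrow> real"
  assumes kernel: "\<And>x y. k x \<bullet> k y = f (x - y)"
    and H_nonneg: "\<And>\<xi>. 0 \<le> H \<xi>" and H_int: "integrable lborel H"
    and inv: "\<And>x. of_real (f x) = (\<integral>\<xi>. H \<xi> * iexp (2 * pi * (x \<bullet> \<xi>)) \<partial>lborel)"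
    and lip: "\<And>t. norm (k (t *\<^sub>R b) - k 0) \<le> B * \<bar>t\<bar>"
  shows "integrable lborel (\<lambda>\<xi>. H \<xi> * (b \<bullet> \<xi>)\<^sup>2)"
proof -
  have [measurable]: "H \<in> borel_measurable borel"
    using H_int by auto
  have f_cos: "f x = (\<integral>\<xi>. H \<xi> * cos (2 * pi * (x \<bullet> \<xi>)) \<partial>lborel)" for x
  proof -
    have int: "integrable lborel (\<lambda>\<xi>. H \<xi> * iexp (2 * pi * (x \<bullet> \<xi>)))"
      by (rule Bochner_Integration.integrable_bound[OF H_int]) (simp_all add: norm_mult)
    have "f x = Re (\<integral>\<xi>. H \<xi> * iexp (2 * pi * (x \<bullet> \<xi>)) \<partial>lborel)"
      by (simp only: inv[symmetric] Re_complex_of_real)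
    also have "\<dots> = (\<integral>\<xi>. Re (H \<xi> * iexp (2 * pi * (x \<bullet> \<xi>))) \<partial>lborel)"
      by (rule integral_Re[OF int, symmetric])
    finally show ?thesis
      by (simp add: Re_exp)
  qed
  have cos_int: "integrable lborel (\<lambda>\<xi>. H \<xi> * cos (2 * pi * (x \<bullet> \<xi>)))" for x
    by (rule Bochner_Integration.integrable_bound[OF H_int]) (simp_all add: abs_mult mult_left_le)
  define t where "t n = inverse (real (Suc n))" for n
  have t_pos: "t n > 0" for n
    by (simp add: t_def)
  define u where "u n \<xi> = H \<xi> * (2 - 2 * cos (2 * pi * (t n *\<^sub>R b \<bullet> \<xi>))) / (t n)\<^sup>2" for n \<xi>
  have u_alt: "u n = (\<lambda>\<xi>. (2 * H \<xi> - 2 * (H \<xi> * cos (2 * pi * (t n *\<^sub>R b \<bullet> \<xi>)))) / (t n)\<^sup>2)" for n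
    by (simp add: u_def fun_eq_iff algebra_simps)
  have "integrable lborel (\<lambda>\<xi>. H \<xi> * (2 * (pi * (b \<bullet> \<xi>)))\<^sup>2)"
  proof (rule integrable_of_bounded_integrals)
    show "integrable lborel (u n)" for n
      unfolding u_alt using H_int cos_int[of "t n *\<^sub>R b"] by (intro integrable_divide_zero Bochner_Integration.integrable_diff integrable_mult_right)
    show "0 \<le> u n \<xi>" for n \<xi>
      using H_nonneg[of \<xi>] by (simp add: u_def)
    show "(\<integral>\<xi>. u n \<xi> \<partial>lborel) \<le> B\<^sup>2" for n
    proof -
      have "(\<integral>\<xi>. u n \<xi> \<partial>lborel) = (2 * f 0 - 2 * f (t n *\<^sub>R b)) / (t n)\<^sup>2"
      proof -
        have "(\<integral>\<xi>. u n \<xi> \<partial>lborel) = (2 * (\<integral>\<xi>. H \<xi> \<partial>lborel) - 2 * (\<integral>\<xi>. H \<xi> * cos (2 * pi * (t n *\<^sub>R b \<bullet> \<xi>)) \<partial>lborel)) / (t n)\<^sup>2"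
          unfolding u_alt by (subst integral_divide_zero, subst Bochner_Integration.integral_diff)
            (use H_int cos_int[of "t n *\<^sub>R b"] in simp_all)
        then show ?thesis
          by (simp add: f_cos)
      qed
      also have "\<dots> = (norm (k (t n *\<^sub>R b) - k 0))\<^sup>2 / (t n)\<^sup>2"
      proof -
        \<comment> \<open>Symmetry of the inner product makes \<open>f\<close> even, so the two
          cross terms of the squared norm agree.\<close>
        have "f (- (t n *\<^sub>R b)) = f (t n *\<^sub>R b)"
          using kernel[of 0 "t n *\<^sub>R b"] kernel[of "t n *\<^sub>R b" 0] by (simp add: inner_commute)
        then show ?thesis
          by (simp add: power2_norm_eq_inner inner_diff_left inner_diff_right kernel)
      qed
      also have "\<dots> \<le> (B * \<bar>t n\<bar>)\<^sup>2 / (t n)\<^sup>2"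
        by (intro divide_right_mono power_mono lip) auto
      also have "\<dots> = B\<^sup>2"
        using t_pos[of n] by (simp add: power_mult_distrib)
      finally show ?thesis .
    qed
    show "(\<lambda>n. u n \<xi>) \<longlonglongrightarrow> H \<xi> * (2 * (pi * (b \<bullet> \<xi>)))\<^sup>2" for \<xi>
    proof -
      define c where "c = pi * (b \<bullet> \<xi>)"
      \<comment> \<open>The half-angle formula turns the second order quotient into the square of a
        first order one, whose limit is the derivative of s \<mapsto> sin (c s) at 0.\<close>
      have u_sin: "u n \<xi> = H \<xi> * (2 * (sin (c * t n) / t n))\<^sup>2" for n
      proof -
        have "2 - 2 * cos (2 * (c * t n)) = (2 * sin (c * t n))\<^sup>2"
          by (simp add: cos_double_sin power_mult_distrib)
        moreover have "2 * pi * (t n *\<^sub>R b \<bullet> \<xi>) = 2 * (c * t n)"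
          by (simp add: c_def)
        ultimately show ?thesis
          by (simp only: u_def) (simp add: power_mult_distrib power_divide)
      qed
      have "((\<lambda>s. sin (c * s)) has_field_derivative c) (at 0)"
        by (auto intro!: derivative_eq_intros)
      then have "((\<lambda>s. sin (c * s) / s) \<longlongrightarrow> c) (at 0)"
        by (simp add: DERIV_def)
      moreover have "filterlim t (at 0) sequentially"
        unfolding filterlim_at t_def using LIMSEQ_inverse_real_of_nat by simp
      ultimately have "(\<lambda>n. sin (c * t n) / t n) \<longlonglongrightarrow> c"
        by (rule filterlim_compose)
      then show ?thesis
        unfolding u_sin c_def[symmetric] by (intro tendsto_intros)
    qed
  qed
  then have "integrable lborel (\<lambda>\<xi>. H \<xi> * (2 * (pi * (b \<bullet> \<xi>)))\<^sup>2 * (1 / (2 * pi)\<^sup>2))"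
    by (rule integrable_mult_left)
  then show ?thesis
    by (simp add: power_mult_distrib)
qed

text \<open>For \<open>k\<^sub>V_hat\<close>, which is prescribed only away from the origin: its
  value there is arbitrary, and one point is a null set. Measurability is recovered too, since
  \<open>F\<close> is \<open>G\<close> altered at one point.\<close>

lemma
  fixes F G :: "'a::euclidean_space \<Rightarrow> 'b::{banach, second_countable_topology}"
  assumes G: "integrable lborel G" and eq: "\<And>x. x \<noteq> 0 \<Longrightarrow> F x = G x"
  shows integrable_lborel_cong_punctured: "integrable lborel F"
    and integral_lborel_cong_punctured: "(\<integral>x. F x \<partial>lborel) = (\<integral>x. G x \<partial>lborel)"
proof -
  have F: "F = (\<lambda>x. if x = 0 then F 0 else G x)"
    using eq by auto
  have [measurable]: "G \<in> borel_measurable borel"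
    using G by auto
  have [measurable]: "F \<in> borel_measurable borel"
    by (subst F) measurable
  have AE: "AE x in lborel. F x = G x"
    by (rule AE_mp[OF AE_lborel_singleton[of 0]]) (simp add: eq)
  show "integrable lborel F"
    using integrable_cong_AE[OF _ _ AE] G by simp
  show "(\<integral>x. F x \<partial>lborel) = (\<integral>x. G x \<partial>lborel)"
    by (rule integral_cong_AE[OF _ _ AE]) simp_all
qed

lemma integrable_vecI:
  fixes F :: "'a \<Rightarrow> 'b::euclidean_space^'n"
  assumes "\<And>i. integrable M (\<lambda>x. F x $ i)"
  shows "integrable M F"
proof -
  have "linear (axis i :: 'b \<Rightarrow> 'b^'n)" for i
    by (rule linearI) (simp_all add: vec_eq_iff axis_def)
  then have "bounded_linear (axis i :: 'b \<Rightarrow> 'b^'n)" for i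
    by (simp add: linear_conv_bounded_linear)
  then have "integrable M (\<lambda>x. \<Sum>i\<in>UNIV. axis i (F x $ i))"
    by (intro Bochner_Integration.integrable_sum integrable_bounded_linear[OF _ assms])
  moreover have "(\<Sum>i\<in>UNIV. axis i (F x $ i)) = F x" for x
    by (simp add: vec_eq_iff axis_def if_distrib cong: if_cong)
  ultimately show ?thesis
    by simp
qed

section \<open>Second derivatives along lines: from the spectrum, and for radial functions\<close>

lemma inverse_fourier_directional_derivative:
  fixes a :: "'a::euclidean_space \<Rightarrow> complex"
  assumes a: "integrable lborel a" and ua: "integrable lborel (\<lambda>\<xi>. (2 * pi * (u \<bullet> \<xi>)) * a \<xi>)"
  shows "((\<lambda>t. \<integral>\<xi>. a \<xi> * iexp (2 * pi * ((x + t *\<^sub>R u) \<bullet> \<xi>)) \<partial>lborel) has_vector_derivative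
    (\<integral>\<xi>. \<i> * (2 * pi * (u \<bullet> \<xi>)) * a \<xi> * iexp (2 * pi * ((x + t *\<^sub>R u) \<bullet> \<xi>)) \<partial>lborel)) (at t)"
proof -
  have [measurable]: "a \<in> borel_measurable borel"
    using a by auto
  define e where "e \<xi> = iexp (2 * pi * (x \<bullet> \<xi>))" for \<xi>
  have e [measurable]: "e \<in> borel_measurable borel"
    unfolding e_def by measurable
  have norm_e: "norm (e \<xi>) = 1" for \<xi>
    by (simp add: e_def)
  have split: "iexp (2 * pi * ((x + t *\<^sub>R u) \<bullet> \<xi>)) = e \<xi> * iexp (t * (2 * pi * (u \<bullet> \<xi>)))" for t \<xi>
    unfolding e_def mult_exp_exp by (simp add: algebra_simps)
  have ae: "integrable lborel (\<lambda>\<xi>. a \<xi> * e \<xi>)"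
    by (rule Bochner_Integration.integrable_bound[OF a]) (simp_all add: norm_mult norm_e)
  have "integrable lborel (\<lambda>\<xi>. (2 * pi * (u \<bullet> \<xi>)) * (a \<xi> * e \<xi>))"
    by (rule Bochner_Integration.integrable_bound[OF ua]) (simp_all add: norm_mult norm_e)
  from has_vector_derivative_integral_iexp[OF ae _ this, of t] show ?thesis
    unfolding split by (simp only: mult.assoc) simp
qed

lemma integrable_mult_inner_square:
  fixes H :: "'a::euclidean_space \<Rightarrow> real"
  assumes H: "integrable lborel H" and H2: "integrable lborel (\<lambda>\<xi>. H \<xi> * (norm \<xi>)\<^sup>2)"
  shows "integrable lborel (\<lambda>\<xi>. H \<xi> * (u \<bullet> \<xi>)\<^sup>2)"
proof (rule Bochner_Integration.integrable_bound)
  show "integrable lborel (\<lambda>\<xi>. (norm u)\<^sup>2 * (H \<xi> * (norm \<xi>)\<^sup>2))"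
    using H2 by simp
  have [measurable]: "H \<in> borel_measurable borel"
    using H by auto
  show "(\<lambda>\<xi>. H \<xi> * (u \<bullet> \<xi>)\<^sup>2) \<in> borel_measurable lborel"
    by measurable
  have "(u \<bullet> \<xi>)\<^sup>2 \<le> (norm u)\<^sup>2 * (norm \<xi>)\<^sup>2" for \<xi>
    using Cauchy_Schwarz_ineq[of u \<xi>] by (simp add: power2_norm_eq_inner)
  from mult_left_mono[OF this, of "\<bar>H _\<bar>"]
  show "AE \<xi> in lborel. norm (H \<xi> * (u \<bullet> \<xi>)\<^sup>2) \<le> norm ((norm u)\<^sup>2 * (H \<xi> * (norm \<xi>)\<^sup>2))"
    by (intro AE_I2) (simp add: abs_mult mult_ac)
qed

text \<open>Each derivative along \<open>u\<close> multiplies the integrand by 2 pi \<i> (u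
  \<bullet> \<xi>), and the square of \<i> accounts for the minus sign. \<open>D2 x u\<close> is the
  Hessian quadratic form at x. Indexing \<open>D1\<close> and \<open>D2\<close> by point and
  direction lets the same function be differentiated again along the same line.\<close>

lemma second_derivative_of_spectrum:
  fixes f H :: "'a::euclidean_space \<Rightarrow> real"
  assumes H: "integrable lborel H" and H2: "integrable lborel (\<lambda>\<xi>. H \<xi> * (norm \<xi>)\<^sup>2)"
    and inv: "\<And>x. of_real (f x) = (\<integral>\<xi>. H \<xi> * iexp (2 * pi * (x \<bullet> \<xi>)) \<partial>lborel)"
  obtains D1 D2 where "\<And>x u t. ((\<lambda>t. f (x + t *\<^sub>R u)) has_real_derivative D1 (x + t *\<^sub>R u) u) (at t)"
    and "\<And>x u t. ((\<lambda>t. D1 (x + t *\<^sub>R u) u) has_real_derivative D2 (x + t *\<^sub>R u) u) (at t)"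
    and "\<And>x u. (\<integral>\<xi>. (2 * pi * (u \<bullet> \<xi>))\<^sup>2 * H \<xi> * iexp (2 * pi * (x \<bullet> \<xi>)) \<partial>lborel) = - complex_of_real (D2 x u)"
proof -
  have [measurable]: "H \<in> borel_measurable borel"
    using H by auto
  note H2u = integrable_mult_inner_square[OF H H2]
  \<comment> \<open>The first moment is dominated by the zeroth and the second, because |s| \<le> 1
    + s^2.\<close>
  have H1u: "integrable lborel (\<lambda>\<xi>. H \<xi> * (u \<bullet> \<xi>))" for u
  proof (rule Bochner_Integration.integrable_bound)
    show "integrable lborel (\<lambda>\<xi>. \<bar>H \<xi>\<bar> + \<bar>H \<xi> * (u \<bullet> \<xi>)\<^sup>2\<bar>)"
      using H H2u by simp
    have "\<bar>s\<bar> \<le> 1 + s\<^sup>2" for s :: real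
    proof -
      have "0 \<le> (\<bar>s\<bar> - 1 / 2)\<^sup>2"
        by simp
      then show ?thesis
        by (simp add: power2_diff power_divide)
    qed
    from mult_left_mono[OF this, of "\<bar>H _\<bar>"]
    show "AE \<xi> in lborel. norm (H \<xi> * (u \<bullet> \<xi>)) \<le> norm (\<bar>H \<xi>\<bar> + \<bar>H \<xi> * (u \<bullet> \<xi>)\<^sup>2\<bar>)"
      by (intro AE_I2) (simp add: abs_mult distrib_left)
  qed measurable
  define a1 where "a1 u \<xi> = \<i> * (2 * pi * (u \<bullet> \<xi>)) * H \<xi>" for u \<xi> :: 'a
  define a2 where "a2 u \<xi> = \<i> * (2 * pi * (u \<bullet> \<xi>)) * a1 u \<xi>" for u \<xi> :: 'a
  define G1 where "G1 x u = (\<integral>\<xi>. a1 u \<xi> * iexp (2 * pi * (x \<bullet> \<xi>)) \<partial>lborel)" for x u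
  define G2 where "G2 x u = (\<integral>\<xi>. a2 u \<xi> * iexp (2 * pi * (x \<bullet> \<xi>)) \<partial>lborel)" for x u
  have int0: "integrable lborel (\<lambda>\<xi>. complex_of_real (H \<xi>))"
    using H by (simp add: complex_of_real_integrable_eq)
  have int1': "integrable lborel (\<lambda>\<xi>. (2 * pi * (u \<bullet> \<xi>)) * complex_of_real (H \<xi>))" for u
  proof -
    have "integrable lborel (\<lambda>\<xi>. complex_of_real (2 * pi * (H \<xi> * (u \<bullet> \<xi>))))"
      using H1u by (simp only: complex_of_real_integrable_eq integrable_mult_right)
    then show ?thesis
      by (simp add: mult_ac)
  qed
  have int1: "integrable lborel (a1 u)" for u
    using integrable_mult_right[OF int1'[of u], of \<i>] by (simp add: a1_def[abs_def] mult_ac)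
  have int2: "integrable lborel (\<lambda>\<xi>. (2 * pi * (u \<bullet> \<xi>)) * a1 u \<xi>)" for u
  proof -
    have "integrable lborel (\<lambda>\<xi>. complex_of_real ((2 * pi)\<^sup>2 * (H \<xi> * (u \<bullet> \<xi>)\<^sup>2)))"
      using H2u by (simp only: complex_of_real_integrable_eq integrable_mult_right)
    from integrable_mult_right[OF this, of \<i>] show ?thesis
      by (simp add: a1_def power2_eq_square mult_ac)
  qed
  have d1: "((\<lambda>t. complex_of_real (f (x + t *\<^sub>R u))) has_vector_derivative G1 (x + t *\<^sub>R u) u) (at t)" for x u t
    using inverse_fourier_directional_derivative[OF int0 int1'] unfolding inv G1_def a1_def .
  have d2: "((\<lambda>t. G1 (x + t *\<^sub>R u) u) has_vector_derivative G2 (x + t *\<^sub>R u) u) (at t)" for x u t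
    using inverse_fourier_directional_derivative[OF int1 int2] unfolding G1_def G2_def a2_def .
  have d1': "((\<lambda>t. f (x + t *\<^sub>R u)) has_real_derivative Re (G1 (x + t *\<^sub>R u) u)) (at t)" for x u t
    using bounded_linear.has_vector_derivative[OF bounded_linear_Re d1[of x u t]]
    by (simp add: has_real_derivative_iff_has_vector_derivative)
  have d2': "((\<lambda>t. Re (G1 (x + t *\<^sub>R u) u)) has_real_derivative Re (G2 (x + t *\<^sub>R u) u)) (at t)" for x u t
    using bounded_linear.has_vector_derivative[OF bounded_linear_Re d2[of x u t]]
    by (simp add: has_real_derivative_iff_has_vector_derivative)
  \<comment> \<open>\<open>G1\<close> and then \<open>G2\<close> are derivatives of real-valued
    functions, so their imaginary parts are derivatives of 0; no symmetry of \<open>H\<close> has to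
    be invoked.\<close>
  have real1: "G1 x u = of_real (Re (G1 x u))" for x u
  proof -
    have "Im (G1 x u) = 0"
      using bounded_linear.has_vector_derivative[OF bounded_linear_Im d1[of x u 0]]
      by (auto dest: vector_derivative_unique_at[OF has_vector_derivative_const])
    then show ?thesis
      by (simp add: complex_eq_iff)
  qed
  have real2: "G2 x u = of_real (Re (G2 x u))" for x u
  proof -
    have "Im (G1 y u) = 0" for y
      by (subst real1) simp
    then have "Im (G2 x u) = 0"
      using bounded_linear.has_vector_derivative[OF bounded_linear_Im d2[of x u 0]]
      by (auto dest: vector_derivative_unique_at[OF has_vector_derivative_const])
    then show ?thesis
      by (simp add: complex_eq_iff)
  qed
  have "(\<integral>\<xi>. (2 * pi * (u \<bullet> \<xi>))\<^sup>2 * H \<xi> * iexp (2 * pi * (x \<bullet> \<xi>)) \<partial>lborel) = - complex_of_real (Re (G2 x u))" for x u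
  proof -
    have "(2 * pi * (u \<bullet> \<xi>))\<^sup>2 * H \<xi> * iexp (2 * pi * (x \<bullet> \<xi>)) = - (a2 u \<xi> * iexp (2 * pi * (x \<bullet> \<xi>)))" for \<xi>
      by (simp add: a2_def a1_def power2_eq_square)
    then show ?thesis
      by (simp only: real2[symmetric]) (simp only: G2_def Bochner_Integration.integral_minus)
  qed
  with d1' d2' show ?thesis
    by (rule that)
qed

text \<open>The second value is the Hessian form of a radial function, k'' on the radial part of
  \<open>u\<close> and k'/r on the tangential part. It is regrouped by (x \<bullet> u)^2 and u
  \<bullet> u, so that each term polarises at sight.\<close>

lemma radial_line_derivatives:
  fixes x u :: "'a::real_inner" and k k1 k2 :: "real \<Rightarrow> real"
  assumes k: "\<And>r. r > 0 \<Longrightarrow> (k has_real_derivative k1 r) (at r)"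
    and k1: "\<And>r. r > 0 \<Longrightarrow> (k1 has_real_derivative k2 r) (at r)"
    and x: "x \<noteq> 0"
  shows "((\<lambda>t. k (norm (x + t *\<^sub>R u))) has_real_derivative k1 (norm x) * (x \<bullet> u) / norm x) (at 0)" (is ?first)
    and "((\<lambda>t. k1 (norm (x + t *\<^sub>R u)) * ((x + t *\<^sub>R u) \<bullet> u) / norm (x + t *\<^sub>R u)) has_real_derivative
      (k2 (norm x) / (norm x)\<^sup>2 - k1 (norm x) / norm x ^ 3) * (x \<bullet> u)\<^sup>2 + k1 (norm x) / norm x * (u \<bullet> u)) (at 0)" (is ?second)
proof -
  have pos: "norm x > 0"
    using x by simp
  have norm: "((\<lambda>t. norm (x + t *\<^sub>R u)) has_real_derivative (x \<bullet> u) / norm x) (at 0)"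
  proof -
    have "norm (x + t *\<^sub>R u) = sqrt (x \<bullet> x + 2 * t * (x \<bullet> u) + t\<^sup>2 * (u \<bullet> u))" for t
      by (simp add: norm_eq_sqrt_inner algebra_simps inner_commute power2_eq_square)
    moreover have "((\<lambda>t. sqrt (x \<bullet> x + 2 * t * (x \<bullet> u) + t\<^sup>2 * (u \<bullet> u))) has_real_derivative (x \<bullet> u) / norm x) (at 0)"
      using inner_ge_zero[of x] x by (auto intro!: derivative_eq_intros simp: norm_eq_sqrt_inner field_simps simp del: inner_ge_zero)
    ultimately show ?thesis
      by simp
  qed
  have inner: "((\<lambda>t. (x + t *\<^sub>R u) \<bullet> u) has_real_derivative u \<bullet> u) (at 0)"
    unfolding inner_add_left inner_scaleR_left by (auto intro!: derivative_eq_intros)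
  show ?first
    using DERIV_chain2[of k "k1 (norm x)" "\<lambda>t. norm (x + t *\<^sub>R u)" 0, OF _ norm] k[OF pos] by simp
  have c: "((\<lambda>t. k1 (norm (x + t *\<^sub>R u))) has_real_derivative k2 (norm x) * ((x \<bullet> u) / norm x)) (at 0)"
    using DERIV_chain2[of k1 "k2 (norm x)" "\<lambda>t. norm (x + t *\<^sub>R u)" 0, OF _ norm] k1[OF pos] by simp
  have alg: "((k2 r * (p / r) * p + q * k1 r) * r - k1 r * p * (p / r)) / (r * r)
      = (k2 r / r\<^sup>2 - k1 r / r ^ 3) * p\<^sup>2 + k1 r / r * q" if "r > 0" for p q r :: real
    using that by (simp add: field_simps power2_eq_square power3_eq_cube)
  show ?second
    using DERIV_divide[OF DERIV_mult[OF c inner] norm] pos alg[OF pos, of "x \<bullet> u" "u \<bullet> u"] by simp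
qed

subsection \<open>Embedding into continuously differentiable fields\<close>

text \<open>A \<open>SUP\<close> dominates its members only if they are bounded above, so this gives
  \<open>C0_norm\<close> its meaning. Decay handles the outside of a ball and compactness the
  inside.\<close>

lemma multi_deriv_bounded:
  assumes u: "u \<in> C0_space s" and p: "sum p UNIV \<le> s"
  shows "bdd_above (range (\<lambda>x. norm (multi_deriv p u x)))"
proof -
  define js where "js = (SOME js. \<forall>i. count_list js i = p i)"
  have js: "\<forall>i. count_list js i = p i"
    unfolding js_def by (rule someI_ex[OF ex_list_multi_index])
  \<comment> \<open>The list behind \<open>multi_deriv\<close> is an arbitrary choice, but its
    length is forced by \<open>p\<close>, and the length is all that \<open>C_diff\<close> asks
    about.\<close>
  have "length js = sum (count_list js) UNIV"
    by (simp add: sum_count_set)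
  also have "\<dots> = sum p UNIV"
    using js by (intro sum.cong) auto
  also note p
  finally have "continuous_on UNIV (partial_derivs js u)"
    using u by (simp add: C0_space_def C_diff_def)
  then have cont: "continuous_on UNIV (\<lambda>x. norm (multi_deriv p u x))"
    unfolding multi_deriv_def js_def by (intro continuous_intros)
  have "(multi_deriv p u \<longlongrightarrow> 0) at_infinity"
    using u p by (simp add: C0_space_def)
  then have "\<forall>\<^sub>F x in at_infinity. dist (multi_deriv p u x) 0 < 1"
    by (rule tendstoD) simp
  then obtain R where R: "\<And>x. norm x \<ge> R \<Longrightarrow> norm (multi_deriv p u x) < 1"
    by (auto simp: eventually_at_infinity)
  have "bounded ((\<lambda>x. norm (multi_deriv p u x)) ` cball 0 R)"
    by (intro compact_imp_bounded compact_continuous_image compact_cball)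
       (rule continuous_on_subset[OF cont], simp)
  then obtain M where "\<forall>x\<in>cball 0 R. norm (multi_deriv p u x) \<le> M"
    by (auto simp: bounded_iff)
  then have M: "norm x \<le> R \<Longrightarrow> norm (multi_deriv p u x) \<le> M" for x
    by simp
  have "norm (multi_deriv p u x) \<le> max M 1" for x
    using R[of x] M[of x] by (cases "norm x \<le> R") auto
  then show ?thesis
    by (auto intro!: bdd_aboveI)
qed

lemma norm_partial_deriv_le_C0_norm:
  fixes u :: "real^'n \<Rightarrow> real^'n"
  assumes u: "u \<in> C0_space s" and s: "s \<ge> 1"
  shows "norm (partial_deriv i u x) \<le> C0_norm s u"
proof -
  define p where "p j = (if j = i then 1 else 0 :: nat)" for j
  have p: "sum p UNIV \<le> s"
    using s by (simp add: p_def[abs_def])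
  \<comment> \<open>For a multi-index of order one the choice in \<open>multi_deriv\<close> is
    forced: only the one-element list has these counts.\<close>
  have unique: "js = [i]" if "\<forall>j. count_list js j = p j" for js
  proof -
    have "set js = {j. count_list js j \<noteq> 0}"
      by (simp add: count_list_0_iff)
    then have set: "set js = {i}"
      using that by (simp add: p_def)
    have "length js = sum (count_list js) UNIV"
      by (simp add: sum_count_set)
    also have "\<dots> = sum p UNIV"
      using that by (intro sum.cong) auto
    finally have "length js = 1"
      by (simp add: p_def[abs_def])
    then show ?thesis
      using set by (cases js) auto
  qed
  have "(SOME js. \<forall>j. count_list js j = p j) = [i]"
    by (rule unique, rule someI_ex, rule ex_list_multi_index)
  then have multi: "multi_deriv p u = partial_deriv i u"
    by (simp add: multi_deriv_def)
  have "norm (multi_deriv p u x) \<le> (SUP x. norm (multi_deriv p u x))"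
    by (rule cSUP_upper[OF _ multi_deriv_bounded[OF u p]]) simp
  also have "\<dots> \<le> C0_norm s u"
    unfolding C0_norm_def
  proof (rule member_le_sum)
    fix q :: "'n \<Rightarrow> nat" assume "q \<in> {p. sum p UNIV \<le> s} - {p}"
    then have "norm (multi_deriv q u 0) \<le> (SUP x. norm (multi_deriv q u x))"
      by (intro cSUP_upper multi_deriv_bounded[OF u]) auto
    then show "0 \<le> (SUP x. norm (multi_deriv q u x))"
      using norm_ge_zero order_trans by blast
  qed (use p finite_multi_indices in auto)
  finally show ?thesis
    by (simp add: multi)
qed

lemma C0_norm_lipschitz:
  fixes u :: "real^'n \<Rightarrow> real^'n"
  assumes u: "u \<in> C0_space s" and s: "s \<ge> 1"
  shows "norm (u (x + t *\<^sub>R axis i 1) - u x) \<le> C0_norm s u * \<bar>t\<bar>"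
proof -
  define g where "g r = u (x + r *\<^sub>R axis i 1)" for r
  have deriv: "(g has_vector_derivative partial_deriv i u (x + r *\<^sub>R axis i 1)) (at r)" for r
  proof -
    have "\<forall>js. length js < s \<longrightarrow> (\<forall>i x. (\<lambda>t. partial_derivs js u (x + t *\<^sub>R axis i 1)) differentiable (at 0))"
      using u by (simp add: C0_space_def C_diff_def)
    from this[rule_format, of "[]"]
    have "(\<lambda>t. u (y + t *\<^sub>R axis i 1)) differentiable (at 0)" for y
      using s by simp
    \<comment> \<open>\<open>C_diff\<close> speaks of the parameter 0 only, but at every base point.
      Moving the base point by \<open>r\<close> and composing with q \<mapsto> q - r gives the
      derivative at \<open>r\<close>; writing 0 as \<open>r - r\<close> matches the chain
      rule.\<close>
    then have "((\<lambda>t. u ((x + r *\<^sub>R axis i 1) + t *\<^sub>R axis i 1)) has_vector_derivative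
        partial_deriv i u (x + r *\<^sub>R axis i 1)) (at (r - r))"
      unfolding partial_deriv_def vector_derivative_works by simp
    then have "((\<lambda>t. u ((x + r *\<^sub>R axis i 1) + t *\<^sub>R axis i 1)) \<circ> (\<lambda>q. q - r) has_vector_derivative
        1 *\<^sub>R partial_deriv i u (x + r *\<^sub>R axis i 1)) (at r)"
      by (intro vector_diff_chain_at) (auto intro!: derivative_eq_intros)
    then show ?thesis
      by (simp add: g_def[abs_def] comp_def algebra_simps)
  qed
  have "norm (g t - g 0) \<le> C0_norm s u * norm (t - 0)"
  proof (rule differentiable_bound[of UNIV])
    show "(g has_derivative (\<lambda>q. q *\<^sub>R partial_deriv i u (x + r *\<^sub>R axis i 1))) (at r within UNIV)" for r
      using deriv[of r] by (simp add: has_vector_derivative_def)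
    show "onorm (\<lambda>q. q *\<^sub>R partial_deriv i u (x + r *\<^sub>R axis i 1)) \<le> C0_norm s u" for r
      by (rule onorm_le) (simp add: mult.commute mult_left_mono norm_partial_deriv_le_C0_norm[OF u s])
  qed auto
  then show ?thesis
    by (simp add: g_def)
qed

text \<open>A linear map continuous at 0 is bounded, combined with the mean value bound along
  coordinate lines. The constant is uniform over the Hilbert space, which is what the difference of
  two representers requires.\<close>

lemma embedded_in_C0_lipschitz:
  fixes \<iota> :: "'w::{real_inner, complete_space} \<Rightarrow> real^'n \<Rightarrow> real^'n"
  assumes emb: "embedded_in_C0 s \<iota>" and s: "s \<ge> 1"
  obtains B where "B \<ge> 0" "\<And>u x t i. norm (\<iota> u (x + t *\<^sub>R axis i 1) - \<iota> u x) \<le> B * norm u * \<bar>t\<bar>"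
proof -
  have scale: "\<iota> (c *\<^sub>R w) = (\<lambda>x. c *\<^sub>R \<iota> w x)" for c w
    using emb by (simp add: embedded_in_C0_def)
  have zero: "\<iota> 0 = (\<lambda>x. 0)"
    using scale[of 0 0] by simp
  have C0: "\<iota> u \<in> C0_space s" for u
    using emb by (auto simp: embedded_in_C0_def)
  have "((\<lambda>v. C0_norm s (\<lambda>x. \<iota> v x - \<iota> 0 x)) \<longlongrightarrow> 0) (at 0)"
    using emb by (simp add: embedded_in_C0_def)
  then have "\<forall>\<^sub>F v in at 0. dist (C0_norm s (\<iota> v)) 0 < 1"
    by (intro tendstoD) (simp_all add: zero)
  then obtain d where d: "d > 0" "\<And>v. v \<noteq> 0 \<Longrightarrow> norm v < d \<Longrightarrow> \<bar>C0_norm s (\<iota> v)\<bar> < 1"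
    by (auto simp: eventually_at)
  have "norm (\<iota> u (x + t *\<^sub>R axis i 1) - \<iota> u x) \<le> 2 / d * norm u * \<bar>t\<bar>" for u x t i
  proof (cases "u = 0")
    case False
    \<comment> \<open>\<open>c\<close> moves u to norm d / 2, strictly inside the ball where
      \<open>C0_norm\<close> stays below 1; dividing by \<open>c\<close> produces the constant 2 /
      d.\<close>
    define c where "c = d / (2 * norm u)"
    have c: "c > 0"
      using False d by (simp add: c_def)
    have "\<bar>C0_norm s (\<iota> (c *\<^sub>R u))\<bar> < 1"
      using False d c by (intro d) (auto simp: c_def)
    then have "C0_norm s (\<iota> (c *\<^sub>R u)) * \<bar>t\<bar> \<le> 1 * \<bar>t\<bar>"
      by (intro mult_right_mono) auto
    with C0_norm_lipschitz[OF C0[of "c *\<^sub>R u"] s, of x t i]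
    have "norm (\<iota> (c *\<^sub>R u) (x + t *\<^sub>R axis i 1) - \<iota> (c *\<^sub>R u) x) \<le> \<bar>t\<bar>"
      by simp
    then have "c * norm (\<iota> u (x + t *\<^sub>R axis i 1) - \<iota> u x) \<le> \<bar>t\<bar>"
      using c by (simp add: scale flip: scaleR_diff_right)
    then show ?thesis
      using False d by (simp add: c_def field_simps)
  qed (simp add: zero)
  then show ?thesis
    using d by (intro that[of "2 / d"]) auto
qed

subsection \<open>Correspondence of the kernels\<close>

theorem proposition4p18:
  fixes s :: nat
    and \<iota> :: "'w::{real_inner, complete_space} \<Rightarrow> real^'n \<Rightarrow> real^'n"
    and K :: "real^'n \<Rightarrow> real^'n \<Rightarrow> real^'n^'n"
    and k\<^sub>W_mat :: "real^'n \<Rightarrow> real^'n^'n"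
    and k\<^sub>W h h\<^sub>V_perp k\<^sub>V_par k\<^sub>V_perp :: "real \<Rightarrow> real"
    and k\<^sub>V_hat k\<^sub>V_mat :: "real^'n \<Rightarrow> complex^'n^'n"
  assumes "CARD('n) \<ge> 2"
    and "s \<ge> 1"
    and "embedded_in_C0 s \<iota>"
    and "reproducing_kernel \<iota> K"
    and "\<And>x y. K x y = k\<^sub>W_mat (x - y)"
    and "integrable lborel k\<^sub>W_mat"
    and "\<And>x. k\<^sub>W_mat x = k\<^sub>W (norm x) *\<^sub>R mat 1"
    and "\<And>\<xi>. fourier (\<lambda>x. complex_mat (k\<^sub>W_mat x)) \<xi> = complex_mat (h (norm \<xi>) *\<^sub>R mat 1)"
    and "\<And>\<rho>. \<rho> > 0 \<Longrightarrow> h\<^sub>V_perp \<rho> = (2 * pi * \<rho>)\<^sup>2 * h \<rho>"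
    and "\<And>\<xi>. \<xi> \<noteq> 0 \<Longrightarrow> k\<^sub>V_hat \<xi> = complex_mat (h\<^sub>V_perp (norm \<xi>) *\<^sub>R Pr_perp \<xi>)"
    and "\<And>x. k\<^sub>V_mat x = inverse_fourier k\<^sub>V_hat x"
    and "\<And>r. r > 0 \<Longrightarrow> k\<^sub>V_par r = - ((real CARD('n) - 1) / r) * deriv k\<^sub>W r"
    and "\<And>r. r > 0 \<Longrightarrow>
           k\<^sub>V_perp r = - ((real CARD('n) - 2) / r) * deriv k\<^sub>W r - deriv (deriv k\<^sub>W) r"
  shows "integrable lborel k\<^sub>V_hat \<and>
    (\<forall>r>0. k\<^sub>W field_differentiable (at r) \<and> deriv k\<^sub>W field_differentiable (at r)) \<and>
    (\<forall>x. x \<noteq> 0 \<longrightarrow>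
       k\<^sub>V_mat x = complex_mat (k\<^sub>V_par (norm x) *\<^sub>R Pr_par x + k\<^sub>V_perp (norm x) *\<^sub>R Pr_perp x))"
proof -
  note emb = assms(3) and repr = assms(4) and KW = assms(5) and kW_int = assms(6) and kW = assms(7)
    and four = assms(8) and hV = assms(9) and kV_hat = assms(10) and kV = assms(11) and kpar = assms(12) and kperp = assms(13)
  define f where "f x = k\<^sub>W (norm x)" for x :: "real^'n"
  define H where "H \<xi> = h (norm \<xi>)" for \<xi> :: "real^'n"
  obtain i0 :: 'n where True
    by simp
  \<comment> \<open>The kernel is a scalar multiple of the identity, so a single unit vector reduces
    it to the scalar \<open>f\<close>. The same vector later spans the ray on which \<open>f\<close>
    becomes \<open>k\<^sub>W\<close>.\<close>
  define \<alpha> where "\<alpha> = (axis i0 1 :: real^'n)"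
  have \<alpha>: "\<alpha> \<bullet> \<alpha> = 1"
    by (simp add: \<alpha>_def inner_axis_axis)
  have K\<alpha>: "K y x *v \<alpha> = f (y - x) *\<^sub>R \<alpha>" for x y
    by (simp add: KW kW f_def scaleR_matrix_vector_assoc[symmetric])
  have "\<forall>x. \<exists>w. \<iota> w = (\<lambda>y. K y x *v \<alpha>) \<and> (\<forall>u. w \<bullet> u = \<alpha> \<bullet> \<iota> u x)"
    using repr by (simp add: reproducing_kernel_def)
  then obtain k where k: "\<And>x. \<iota> (k x) = (\<lambda>y. K y x *v \<alpha>)" and k_inner: "\<And>x u. k x \<bullet> u = \<alpha> \<bullet> \<iota> u x"
    by metis
  have kernel: "k x \<bullet> k y = f (x - y)" for x y
    by (simp add: k_inner k K\<alpha> \<alpha>)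
  have cont: "continuous_on UNIV (\<lambda>x. k x \<bullet> u)" for u
  proof -
    have "\<iota> u \<in> C0_space s"
      using emb by (auto simp: embedded_in_C0_def)
    then have "C_diff s (\<iota> u)"
      by (simp add: C0_space_def)
    then have "\<forall>js. length js \<le> s \<longrightarrow> continuous_on UNIV (partial_derivs js (\<iota> u))"
      by (simp add: C_diff_def)
    from this[rule_format, of "[]"] have "continuous_on UNIV (\<iota> u)"
      by simp
    then show ?thesis
      unfolding k_inner by (intro continuous_intros)
  qed
  obtain B where B: "B \<ge> 0" "\<And>u x t i. norm (\<iota> u (x + t *\<^sub>R axis i 1) - \<iota> u x) \<le> B * norm u * \<bar>t\<bar>"
    using embedded_in_C0_lipschitz[OF emb \<open>s \<ge> 1\<close>] by blast
  \<comment> \<open>The difference \<open>w\<close> of two representers is paired with itself: the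
    reproducing property turns |w|^2 into an increment of \<iota> w, which is at most B |w|
    |t|.\<close>
  have lip: "norm (k (t *\<^sub>R axis i 1) - k 0) \<le> B * \<bar>t\<bar>" for t and i :: 'n
  proof -
    define w where "w = k (t *\<^sub>R axis i 1) - k 0"
    have "norm w * norm w = w \<bullet> w"
      by (simp add: norm_eq_sqrt_inner)
    also have "\<dots> = k (t *\<^sub>R axis i 1) \<bullet> w - k 0 \<bullet> w"
      by (subst w_def) (simp add: inner_diff_left)
    also have "\<dots> = \<alpha> \<bullet> (\<iota> w (0 + t *\<^sub>R axis i 1) - \<iota> w 0)"
      by (simp add: k_inner inner_diff_right)
    also have "\<dots> \<le> norm \<alpha> * norm (\<iota> w (0 + t *\<^sub>R axis i 1) - \<iota> w 0)"
      by (rule norm_cauchy_schwarz)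
    also have "\<dots> \<le> (B * \<bar>t\<bar>) * norm w"
      using B(2)[of w 0 t i] by (simp add: \<alpha>_def mult_ac)
    finally have "norm w \<le> B * \<bar>t\<bar>"
      using B(1) by (cases "norm w = 0") (auto simp: mult_le_cancel_right)
    then show ?thesis
      by (simp add: w_def)
  qed
  have f_int: "integrable lborel f"
  proof -
    have "bounded_linear (\<lambda>A :: real^'n^'n. A $ i0 $ i0)"
      using bounded_linear_compose[OF bounded_linear_vec_nth bounded_linear_vec_nth] by blast
    from integrable_bounded_linear[OF this kW_int] show ?thesis
      by (simp add: kW f_def[abs_def] mat_def)
  qed
  have H: "(\<integral>y. f y * iexp (- (2 * pi * (y \<bullet> \<xi>))) \<partial>lborel) = of_real (H \<xi>)" for \<xi>
    using arg_cong[OF four[of \<xi>], of "\<lambda>A. A $ i0 $ i0"]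
    by (simp add: fourier_def map_matrix_def kW f_def H_def mat_def mult_ac)
  note spectrum = translation_kernel_spectrum[OF kernel cont f_int H]
  \<comment> \<open>The Lipschitz bound is available along coordinate axes only, and this suffices
    since |\<xi>|^2 is the sum of the squared coordinates.\<close>
  have H2: "integrable lborel (\<lambda>\<xi>. H \<xi> * (\<xi> $ i)\<^sup>2)" for i
    using translation_kernel_second_moment[OF kernel spectrum lip, of i] by (simp add: inner_axis')
  have norm_sq: "(norm \<xi>)\<^sup>2 = (\<Sum>i\<in>UNIV. (\<xi> $ i)\<^sup>2)" for \<xi> :: "real^'n"
    unfolding power2_norm_eq_inner inner_vec_def by (simp add: power2_eq_square)
  have H_norm2: "integrable lborel (\<lambda>\<xi>. H \<xi> * (norm \<xi>)\<^sup>2)"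
    unfolding norm_sq sum_distrib_left by (intro Bochner_Integration.integrable_sum H2)
  obtain D1 D2 where D1: "\<And>x u t. ((\<lambda>t. f (x + t *\<^sub>R u)) has_real_derivative D1 (x + t *\<^sub>R u) u) (at t)"
    and D2: "\<And>x u t. ((\<lambda>t. D1 (x + t *\<^sub>R u) u) has_real_derivative D2 (x + t *\<^sub>R u) u) (at t)"
    and D2_int: "\<And>x u. (\<integral>\<xi>. (2 * pi * (u \<bullet> \<xi>))\<^sup>2 * H \<xi> * iexp (2 * pi * (x \<bullet> \<xi>)) \<partial>lborel) = - complex_of_real (D2 x u)"
    using second_derivative_of_spectrum[OF spectrum(2) H_norm2 spectrum(3)] by blast
  \<comment> \<open>Differentiability of the profile is not assumed; it is inherited from
    \<open>f\<close> on the ray r \<mapsto> r \<alpha>, where r > 0 is needed for the norm to be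
    r.\<close>
  have transform: "(k\<^sub>W has_real_derivative D1 (r *\<^sub>R \<alpha>) \<alpha>) (at r)" if "r > 0" for r
  proof (rule has_field_derivative_transform_within_open)
    show "((\<lambda>r. f (0 + r *\<^sub>R \<alpha>)) has_real_derivative D1 (r *\<^sub>R \<alpha>) \<alpha>) (at r)"
      using D1[of 0 \<alpha> r] by simp
    show "f (0 + r *\<^sub>R \<alpha>) = k\<^sub>W r" if "r \<in> {0<..}" for r
      using that by (simp add: f_def \<alpha>_def)
  qed (use that in auto)
  then have deriv_kW: "deriv k\<^sub>W r = D1 (r *\<^sub>R \<alpha>) \<alpha>" if "r > 0" for r
    using that by (blast intro: DERIV_imp_deriv)
  have k1: "(k\<^sub>W has_real_derivative deriv k\<^sub>W r) (at r)" if "r > 0" for r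
    using transform[OF that] deriv_kW[OF that] by simp
  have transform2: "(deriv k\<^sub>W has_real_derivative D2 (r *\<^sub>R \<alpha>) \<alpha>) (at r)" if "r > 0" for r
  proof (rule has_field_derivative_transform_within_open)
    show "((\<lambda>r. D1 (0 + r *\<^sub>R \<alpha>) \<alpha>) has_real_derivative D2 (r *\<^sub>R \<alpha>) \<alpha>) (at r)"
      using D2[of 0 \<alpha> r] by simp
    show "D1 (0 + r *\<^sub>R \<alpha>) \<alpha> = deriv k\<^sub>W r" if "r \<in> {0<..}" for r
      using that by (simp add: deriv_kW)
  qed (use that in auto)
  then have k2: "(deriv k\<^sub>W has_real_derivative deriv (deriv k\<^sub>W) r) (at r)" if "r > 0" for r
    using that DERIV_imp_deriv by metis
  have D2_eq: "D2 x u = (deriv (deriv k\<^sub>W) (norm x) / (norm x)\<^sup>2 - deriv k\<^sub>W (norm x) / norm x ^ 3) * (x \<bullet> u)\<^sup>2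
      + deriv k\<^sub>W (norm x) / norm x * (u \<bullet> u)" if x: "x \<noteq> 0" for x u
  proof -
    have D1_eq: "D1 y u = deriv k\<^sub>W (norm y) * (y \<bullet> u) / norm y" if "y \<noteq> 0" for y
      using DERIV_unique[OF D1[of y u 0, unfolded f_def] radial_line_derivatives(1)[OF k1 k2 that]] by simp
    \<comment> \<open>The radial formula for \<open>D1\<close> fails at the origin, which the line
      may meet for some t. It holds for t near 0, and this is enough to differentiate it
      there.\<close>
    have "((\<lambda>t. x + t *\<^sub>R u) \<longlongrightarrow> x + 0 *\<^sub>R u) (at 0)"
      by (intro tendsto_intros)
    then have "\<forall>\<^sub>F t in at 0. x + t *\<^sub>R u \<noteq> 0"
      using x by (intro tendsto_imp_eventually_ne) auto
    then have "\<forall>\<^sub>F t in nhds 0. x + t *\<^sub>R u \<noteq> 0"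
      using x by (simp add: eventually_nhds_conv_at)
    then have ev: "\<forall>\<^sub>F t in nhds 0. D1 (x + t *\<^sub>R u) u = deriv k\<^sub>W (norm (x + t *\<^sub>R u)) * ((x + t *\<^sub>R u) \<bullet> u) / norm (x + t *\<^sub>R u)"
      by (rule eventually_mono) (rule D1_eq)
    show ?thesis
      using DERIV_unique[OF D2[of x u 0] iffD2[OF DERIV_cong_ev[OF refl ev refl] radial_line_derivatives(2)[OF k1 k2 x]]] by simp
  qed
  have H_meas [measurable]: "H \<in> borel_measurable borel"
    using spectrum(2) by auto
  \<comment> \<open>The entries of |\<xi>|^2 times \<open>Pr_perp\<close>: the factor \<rho>^2 in
    \<open>h\<^sub>V_perp\<close> cancels the singularity of the projection, leaving a polynomial
    dominated by the second moment.\<close>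
  define P where "P i j \<xi> = (if i = j then (norm \<xi>)\<^sup>2 else 0) - \<xi> $ i * \<xi> $ j" for i j and \<xi> :: "real^'n"
  have P_meas [measurable]: "P i j \<in> borel_measurable borel" for i j
    unfolding P_def by measurable
  have hat_entry: "k\<^sub>V_hat \<xi> $ i $ j = (2 * pi)\<^sup>2 * H \<xi> * P i j \<xi>" if "\<xi> \<noteq> 0" for \<xi> i j
  proof -
    have "h\<^sub>V_perp (norm \<xi>) * Pr_perp \<xi> $ i $ j = (2 * pi)\<^sup>2 * H \<xi> * P i j \<xi>"
      using that by (simp add: hV H_def Pr_perp_def Pr_par_def P_def mat_def field_simps)
    then show ?thesis
      using that by (simp add: kV_hat map_matrix_def flip: of_real_mult of_real_power)
  qed
  have HP_int: "integrable lborel (\<lambda>\<xi>. complex_of_real ((2 * pi)\<^sup>2 * H \<xi> * P i j \<xi>))" for i j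
  proof -
    have "\<bar>\<xi> $ i * \<xi> $ j\<bar> \<le> (norm \<xi>)\<^sup>2" for \<xi> :: "real^'n"
      unfolding abs_mult power2_eq_square by (intro mult_mono component_le_norm_cart) auto
    then have "\<bar>P i j \<xi>\<bar> \<le> 2 * (norm \<xi>)\<^sup>2" for \<xi>
      unfolding P_def by (smt (verit) zero_le_power2)
    from mult_left_mono[OF this, of "(2 * pi)\<^sup>2 * H _"]
    have "\<bar>(2 * pi)\<^sup>2 * H \<xi> * P i j \<xi>\<bar> \<le> \<bar>(2 * (2 * pi)\<^sup>2) * (H \<xi> * (norm \<xi>)\<^sup>2)\<bar>" for \<xi>
      using spectrum(1)[of \<xi>] by (simp add: abs_mult mult_ac)
    then show ?thesis
      unfolding complex_of_real_integrable_eq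
      by (intro Bochner_Integration.integrable_bound[OF integrable_mult_right[OF H_norm2, of "2 * (2 * pi)\<^sup>2"]]) auto
  qed
  have kV_hat_int: "integrable lborel k\<^sub>V_hat"
    by (intro integrable_vecI integrable_lborel_cong_punctured[OF HP_int hat_entry])
  have kV_entry: "k\<^sub>V_mat x $ i $ j = complex_mat (k\<^sub>V_par (norm x) *\<^sub>R Pr_par x + k\<^sub>V_perp (norm x) *\<^sub>R Pr_perp x) $ i $ j"
    if x: "x \<noteq> 0" for x i j
  proof -
    define r where "r = norm x"
    have r: "r > 0"
      using x by (simp add: r_def)
    \<comment> \<open>With these coefficients the Hessian of \<open>f\<close> at x is a x x^T + b
      I.\<close>
    define a where "a = deriv (deriv k\<^sub>W) r / r\<^sup>2 - deriv k\<^sub>W r / r ^ 3"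
    define b where "b = deriv k\<^sub>W r / r"
    define E where "E \<xi> = iexp (2 * pi * (x \<bullet> \<xi>))" for \<xi>
    \<comment> \<open>\<open>T u v\<close> integrates to minus the Hessian form at (u, v).
      \<open>D2_int\<close> covers u = v, and polarisation the rest.\<close>
    define T where "T u v \<xi> = of_real (2 * pi * (u \<bullet> \<xi>) * (2 * pi * (v \<bullet> \<xi>)) * H \<xi>) * E \<xi>" for u v \<xi>
    have E_meas [measurable]: "E \<in> borel_measurable borel"
      unfolding E_def by measurable
    have T_diag: "has_bochner_integral lborel (T u u) (- of_real (a * (x \<bullet> u)\<^sup>2 + b * (u \<bullet> u)))" for u
    proof -
      have "integrable lborel (T u u)"
      proof (rule Bochner_Integration.integrable_bound)
        show "integrable lborel (\<lambda>\<xi>. (2 * pi)\<^sup>2 * (H \<xi> * (u \<bullet> \<xi>)\<^sup>2))"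
          using integrable_mult_inner_square[OF spectrum(2) H_norm2] by (rule integrable_mult_right)
        have "T u u \<xi> = of_real ((2 * pi)\<^sup>2 * (H \<xi> * (u \<bullet> \<xi>)\<^sup>2)) * E \<xi>" for \<xi>
          by (simp add: T_def power2_eq_square mult_ac)
        then have "norm (T u u \<xi>) = norm ((2 * pi)\<^sup>2 * (H \<xi> * (u \<bullet> \<xi>)\<^sup>2))" for \<xi>
          by (simp only: norm_mult[of _ "E \<xi>"] norm_of_real real_norm_def) (simp add: E_def abs_mult)
        then show "AE \<xi> in lborel. norm (T u u \<xi>) \<le> norm ((2 * pi)\<^sup>2 * (H \<xi> * (u \<bullet> \<xi>)\<^sup>2))"
          by simp
      qed (simp add: T_def[abs_def])
      moreover have "T u u \<xi> = (2 * pi * (u \<bullet> \<xi>))\<^sup>2 * H \<xi> * iexp (2 * pi * (x \<bullet> \<xi>))" for \<xi>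
        by (simp add: T_def E_def power2_eq_square)
      then have "integral\<^sup>L lborel (T u u) = - of_real (D2 x u)"
        unfolding D2_int[symmetric] by (intro Bochner_Integration.integral_cong refl)
      ultimately show ?thesis
        by (simp only: has_bochner_integral_iff D2_eq[OF x] a_def b_def r_def)
    qed
    have T: "has_bochner_integral lborel (T u v) (- of_real (a * (x \<bullet> u) * (x \<bullet> v) + b * (u \<bullet> v)))" for u v
    proof -
      have "has_bochner_integral lborel (\<lambda>\<xi>. 1 / 2 * (T (u + v) (u + v) \<xi> - T u u \<xi> - T v v \<xi>))
        (1 / 2 * (- of_real (a * (x \<bullet> (u + v))\<^sup>2 + b * ((u + v) \<bullet> (u + v)))
          - - of_real (a * (x \<bullet> u)\<^sup>2 + b * (u \<bullet> u)) - - of_real (a * (x \<bullet> v)\<^sup>2 + b * (v \<bullet> v))))"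
        by (intro has_bochner_integral_mult_right has_bochner_integral_diff T_diag)
      moreover have "1 / 2 * (T (u + v) (u + v) \<xi> - T u u \<xi> - T v v \<xi>) = T u v \<xi>" for \<xi>
        by (simp add: T_def algebra_simps)
      moreover have "1 / 2 * (- complex_of_real (a * (x \<bullet> (u + v))\<^sup>2 + b * ((u + v) \<bullet> (u + v)))
          - - of_real (a * (x \<bullet> u)\<^sup>2 + b * (u \<bullet> u)) - - of_real (a * (x \<bullet> v)\<^sup>2 + b * (v \<bullet> v)))
          = - of_real (a * (x \<bullet> u) * (x \<bullet> v) + b * (u \<bullet> v))"
        by (simp add: inner_commute algebra_simps power2_eq_square)
      ultimately show ?thesis
        by (simp only:)
    qed
    let ?e = "\<lambda>l. axis l 1 :: real^'n"
    \<comment> \<open>This is the entry (i, j) of -Laplacian I + Hess, the Laplacian being the trace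
      over the coordinate axes.\<close>
    have "has_bochner_integral lborel (\<lambda>\<xi>. (if i = j then 1 else 0) * (\<Sum>l\<in>UNIV. T (?e l) (?e l) \<xi>) - T (?e i) (?e j) \<xi>)
        ((if i = j then 1 else 0) * (\<Sum>l\<in>UNIV. - complex_of_real (a * (x \<bullet> ?e l) * (x \<bullet> ?e l) + b * (?e l \<bullet> ?e l)))
          - - complex_of_real (a * (x \<bullet> ?e i) * (x \<bullet> ?e j) + b * (?e i \<bullet> ?e j)))"
      by (intro has_bochner_integral_diff has_bochner_integral_mult_right has_bochner_integral_sum T)
    moreover have "(if i = j then 1 else 0) * (\<Sum>l\<in>UNIV. T (?e l) (?e l) \<xi>) - T (?e i) (?e j) \<xi>
        = of_real ((2 * pi)\<^sup>2 * H \<xi> * P i j \<xi>) * E \<xi>" for \<xi>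
    proof -
      have T_axis: "T (?e l) (?e m) \<xi> = of_real ((2 * pi)\<^sup>2 * H \<xi> * (\<xi> $ l * \<xi> $ m)) * E \<xi>" for l m
        by (simp add: T_def inner_axis' power2_eq_square mult_ac)
      have "(\<Sum>l\<in>UNIV. T (?e l) (?e l) \<xi>) = of_real ((2 * pi)\<^sup>2 * H \<xi> * (norm \<xi>)\<^sup>2) * E \<xi>"
        by (simp only: T_axis sum_distrib_right[symmetric] of_real_sum[symmetric] sum_distrib_left[symmetric]
            norm_sq[of \<xi>, unfolded power2_eq_square[of "_ $ _"]])
      with T_axis[of i j] show ?thesis
        by (simp add: P_def algebra_simps)
    qed
    \<comment> \<open>The trace of b I contributes d b on the diagonal and the Hessian entry gives
      one b back, whence the factor d - 1.\<close>
    moreover have "(if i = j then 1 else 0) * (\<Sum>l\<in>UNIV. - complex_of_real (a * (x \<bullet> ?e l) * (x \<bullet> ?e l) + b * (?e l \<bullet> ?e l)))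
          - - complex_of_real (a * (x \<bullet> ?e i) * (x \<bullet> ?e j) + b * (?e i \<bullet> ?e j))
        = of_real (a * (x $ i * x $ j) - (if i = j then a * r\<^sup>2 + (real CARD('n) - 1) * b else 0))"
    proof -
      have "(\<Sum>l\<in>UNIV. - complex_of_real (a * (x \<bullet> ?e l) * (x \<bullet> ?e l) + b * (?e l \<bullet> ?e l)))
          = - of_real (a * r\<^sup>2 + real CARD('n) * b)"
      proof -
        have "(\<Sum>l\<in>UNIV. a * (x \<bullet> ?e l) * (x \<bullet> ?e l) + b * (?e l \<bullet> ?e l)) = a * r\<^sup>2 + real CARD('n) * b"
          unfolding r_def norm_sq
          by (simp add: inner_axis inner_axis_axis sum.distrib sum_distrib_left power2_eq_square mult.assoc)
        then show ?thesis
          by (simp only: sum_negf of_real_sum[symmetric])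
      qed
      moreover have "axis i 1 $ j = (if i = j then 1 else 0 :: real)"
        by (simp add: axis_def)
      ultimately show ?thesis
        by (simp only: inner_axis) (auto simp: algebra_simps)
    qed
    ultimately have "has_bochner_integral lborel (\<lambda>\<xi>. of_real ((2 * pi)\<^sup>2 * H \<xi> * P i j \<xi>) * E \<xi>)
        (complex_of_real (a * (x $ i * x $ j) - (if i = j then a * r\<^sup>2 + (real CARD('n) - 1) * b else 0)))"
      by (simp only:)
    then have int: "integrable lborel (\<lambda>\<xi>. of_real ((2 * pi)\<^sup>2 * H \<xi> * P i j \<xi>) * E \<xi>)"
      and eq: "(\<integral>\<xi>. of_real ((2 * pi)\<^sup>2 * H \<xi> * P i j \<xi>) * E \<xi> \<partial>lborel)
        = complex_of_real (a * (x $ i * x $ j) - (if i = j then a * r\<^sup>2 + (real CARD('n) - 1) * b else 0))"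
      by (simp_all only: has_bochner_integral_iff)
    have E_exp: "exp (2 * pi * \<i> * complex_of_real (x \<bullet> \<xi>)) = E \<xi>" for \<xi>
      by (simp add: E_def mult_ac)
    have "k\<^sub>V_mat x $ i $ j = (\<integral>\<xi>. k\<^sub>V_hat \<xi> $ i $ j * E \<xi> \<partial>lborel)"
      by (simp only: kV inverse_fourier_def vec_lambda_beta E_exp)
    also have "\<dots> = of_real (a * (x $ i * x $ j) - (if i = j then a * r\<^sup>2 + (real CARD('n) - 1) * b else 0))"
      unfolding eq[symmetric] by (rule integral_lborel_cong_punctured[OF int]) (rule arg_cong2[where f="(*)", OF hat_entry refl])
    also have "a * (x $ i * x $ j) - (if i = j then a * r\<^sup>2 + (real CARD('n) - 1) * b else 0)
        = (k\<^sub>V_par r *\<^sub>R Pr_par x + k\<^sub>V_perp r *\<^sub>R Pr_perp x) $ i $ j"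
    proof -
      \<comment> \<open>Since the projections sum to the identity, it suffices to match two
        coefficients: that of x x^T / r^2, the difference of the profiles, and that of the identity,
        \<open>k\<^sub>V_perp r\<close>.\<close>
      have "(k\<^sub>V_par r *\<^sub>R Pr_par x + k\<^sub>V_perp r *\<^sub>R Pr_perp x) $ i $ j
          = (k\<^sub>V_par r - k\<^sub>V_perp r) * (x $ i * x $ j / r\<^sup>2) + (if i = j then k\<^sub>V_perp r else 0)"
        by (simp add: Pr_perp_def Pr_par_def mat_def r_def algebra_simps diff_divide_distrib)
      moreover have "k\<^sub>V_par r - k\<^sub>V_perp r = a * r\<^sup>2"
        using r by (simp add: kpar kperp a_def field_simps power2_eq_square power3_eq_cube)
      moreover have "k\<^sub>V_perp r = - (a * r\<^sup>2 + (real CARD('n) - 1) * b)"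
        using r by (simp add: kperp a_def b_def field_simps power2_eq_square power3_eq_cube)
      ultimately have "(k\<^sub>V_par r *\<^sub>R Pr_par x + k\<^sub>V_perp r *\<^sub>R Pr_perp x) $ i $ j
          = a * r\<^sup>2 * (x $ i * x $ j / r\<^sup>2) + (if i = j then - (a * r\<^sup>2 + (real CARD('n) - 1) * b) else 0)"
        by (simp only:)
      then show ?thesis
        using r by simp
    qed
    finally show ?thesis
      by (simp add: map_matrix_def r_def)
  qed
  \<comment> \<open>Integrals and \<open>deriv\<close> are total, with default values where they do
    not exist; the first two conjuncts certify that the third is about genuine ones.\<close>
  show ?thesis
  proof (intro conjI allI impI)
    show "k\<^sub>V_mat x = complex_mat (k\<^sub>V_par (norm x) *\<^sub>R Pr_par x + k\<^sub>V_perp (norm x) *\<^sub>R Pr_perp x)" if "x \<noteq> 0" for x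
      unfolding vec_eq_iff using kV_entry[OF that] by blast
  qed (use kV_hat_int k1 k2 in \<open>auto simp: field_differentiable_def\<close>)
qed

end
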